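(* Let $R\subseteq S$ be an integral t-closed FCP extension. Then $R\subseteq S$ is distributive if and only if all its residual extensions $\kappa_R(Q\cap R)\to\kappa_S(Q)$, for $Q\in\mathrm{Spec}(S)$, are distributive.
   Context: All rings are commutative with unit. $[R,S]$ denotes the set of all $R$-subalgebras of $S$, ordered by inclusion; it is a lattice in which the infimum of $T,U$ is $T\cap U$ and the supremum is the compositum $TU$. The extension $R\subseteq S$ is called distributive if the lattice $[R,S]$ is distributive (for field extensions this is applied to the same lattice of intermediate rings). It has FCP if every chain in $[R,S]$ is finite. An extension $R\subseteq S$ is t-closed if the relations $b\in S$, $r\in R$, $b^2-rb\in R$, $b^3-rb^2\in R$ imply $b\in R$. For a prime ideal $P$ of $R$, $\kappa_R(P):=R_P/PR_P$. *)

theory Defs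
  imports "HOL-Algebra.Algebra"
begin

text \<open>
  A ring extension is given by a commutative ring \<open>S\<close> together with a subring \<open>R \<subseteq> carrier S\<close>
  (\<open>subring\<close> entails that \<open>R\<close> contains the unit of \<open>S\<close>); the ring \<open>R\<close> itself is
  \<open>S\<lparr>carrier := R\<rparr>\<close>.  The zero ring is not excluded.
\<close>

definition intermediate_rings :: "'a set \<Rightarrow> ('a, 'b) ring_scheme \<Rightarrow> 'a set set" where
  "intermediate_rings R S = {T. subring T S \<and> R \<subseteq> T}"

definition compositum :: "('a, 'b) ring_scheme \<Rightarrow> 'a set \<Rightarrow> 'a set \<Rightarrow> 'a set" where
  "compositum S T U = generate_ring S (T \<union> U)"

definition distributive_ext :: "'a set \<Rightarrow> ('a, 'b) ring_scheme \<Rightarrow> bool" where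
  "distributive_ext R S \<longleftrightarrow>
     (\<forall>T \<in> intermediate_rings R S. \<forall>U \<in> intermediate_rings R S. \<forall>V \<in> intermediate_rings R S.
        T \<inter> compositum S U V = compositum S (T \<inter> U) (T \<inter> V))"

definition FCP_ext :: "'a set \<Rightarrow> ('a, 'b) ring_scheme \<Rightarrow> bool" where
  "FCP_ext R S \<longleftrightarrow> (\<forall>C. subset.chain (intermediate_rings R S) C \<longrightarrow> finite C)"

text \<open>
  Polynomials are coefficient lists with the leading coefficient first, so
  \<open>\<one>\<^bsub>S\<^esub> # p\<close> is the general monic polynomial.
\<close>
definition integral_ext :: "'a set \<Rightarrow> ('a, 'b) ring_scheme \<Rightarrow> bool" where
  "integral_ext R S \<longleftrightarrow>
     (\<forall>x \<in> carrier S. \<exists>p. set p \<subseteq> R \<and> ring.eval S (\<one>\<^bsub>S\<^esub> # p) x = \<zero>\<^bsub>S\<^esub>)"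

definition t_closed_ext :: "'a set \<Rightarrow> ('a, 'b) ring_scheme \<Rightarrow> bool" where
  "t_closed_ext R S \<longleftrightarrow>
     (\<forall>b \<in> carrier S. \<forall>r \<in> R.
        b [^]\<^bsub>S\<^esub> (2::nat) \<ominus>\<^bsub>S\<^esub> r \<otimes>\<^bsub>S\<^esub> b \<in> R \<longrightarrow>
        b [^]\<^bsub>S\<^esub> (3::nat) \<ominus>\<^bsub>S\<^esub> r \<otimes>\<^bsub>S\<^esub> b [^]\<^bsub>S\<^esub> (2::nat) \<in> R \<longrightarrow> b \<in> R)"


text \<open>
  Localization of a commutative ring \<open>A\<close> at a multiplicative set \<open>M\<close>.  The elements are the
  equivalence classes of pairs, and \<open>loc_frac A M a s\<close> is the fraction \<open>a / s\<close>.
\<close>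

definition loc_rel :: "('a, 'b) ring_scheme \<Rightarrow> 'a set \<Rightarrow> (('a \<times> 'a) \<times> ('a \<times> 'a)) set" where
  "loc_rel A M = {((a, s), (b, t)). a \<in> carrier A \<and> s \<in> M \<and> b \<in> carrier A \<and> t \<in> M \<and>
     (\<exists>u \<in> M. u \<otimes>\<^bsub>A\<^esub> (a \<otimes>\<^bsub>A\<^esub> t) = u \<otimes>\<^bsub>A\<^esub> (b \<otimes>\<^bsub>A\<^esub> s))}"

definition loc_frac :: "('a, 'b) ring_scheme \<Rightarrow> 'a set \<Rightarrow> 'a \<Rightarrow> 'a \<Rightarrow> ('a \<times> 'a) set" where
  "loc_frac A M a s = loc_rel A M `` {(a, s)}"

definition localization :: "('a, 'b) ring_scheme \<Rightarrow> 'a set \<Rightarrow> ('a \<times> 'a) set ring" where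
  "localization A M =
     \<lparr>carrier = (carrier A \<times> M) // loc_rel A M,
      monoid.mult = (\<lambda>x y. \<Union>(a, s) \<in> x. \<Union>(b, t) \<in> y. loc_frac A M (a \<otimes>\<^bsub>A\<^esub> b) (s \<otimes>\<^bsub>A\<^esub> t)),
      one = loc_frac A M \<one>\<^bsub>A\<^esub> \<one>\<^bsub>A\<^esub>,
      ring.zero = loc_frac A M \<zero>\<^bsub>A\<^esub> \<one>\<^bsub>A\<^esub>,
      ring.add = (\<lambda>x y. \<Union>(a, s) \<in> x. \<Union>(b, t) \<in> y.
               loc_frac A M (a \<otimes>\<^bsub>A\<^esub> t \<oplus>\<^bsub>A\<^esub> b \<otimes>\<^bsub>A\<^esub> s) (s \<otimes>\<^bsub>A\<^esub> t))\<rparr>"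

definition loc_prime :: "('a, 'b) ring_scheme \<Rightarrow> 'a set \<Rightarrow> ('a \<times> 'a) set ring" where
  "loc_prime A P = localization A (carrier A - P)"

definition loc_ideal :: "('a, 'b) ring_scheme \<Rightarrow> 'a set \<Rightarrow> ('a \<times> 'a) set set" where
  "loc_ideal A P = Idl\<^bsub>loc_prime A P\<^esub> ((\<lambda>p. loc_frac A (carrier A - P) p \<one>\<^bsub>A\<^esub>) ` P)"

definition residue_field :: "('a, 'b) ring_scheme \<Rightarrow> 'a set \<Rightarrow> ('a \<times> 'a) set set ring" where
  "residue_field A P = loc_prime A P Quot loc_ideal A P"

text \<open>
  For a prime ideal \<open>Q\<close> of \<open>S\<close>, the canonical maps from \<open>R\<close> localized at \<open>Q \<inter> R\<close> to \<open>S\<close>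
  localized at \<open>Q\<close>, sending \<open>a / s\<close> to \<open>a / s\<close>, and between the residue fields, sending the
  class of \<open>x\<close> to the class of its image.  The sets united over all representatives
  coincide because the maps are well defined.
\<close>

definition loc_map :: "('a, 'b) ring_scheme \<Rightarrow> 'a set \<Rightarrow> ('a \<times> 'a) set \<Rightarrow> ('a \<times> 'a) set" where
  "loc_map S Q x = (\<Union>(a, s) \<in> x. loc_frac S (carrier S - Q) a s)"

definition residual_map ::
  "('a, 'b) ring_scheme \<Rightarrow> 'a set \<Rightarrow> ('a \<times> 'a) set set \<Rightarrow> ('a \<times> 'a) set set" where
  "residual_map S Q C = (\<Union>x \<in> C. loc_ideal S Q +>\<^bsub>loc_prime S Q\<^esub> loc_map S Q x)"

text \<open>
  The residual extension is viewed inside the residue field of \<open>S\<close> through the image of the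
  residue field of \<open>R\<close>.
\<close>
definition distributive_residual_ext :: "'a set \<Rightarrow> ('a, 'b) ring_scheme \<Rightarrow> 'a set \<Rightarrow> bool" where
  "distributive_residual_ext R S Q \<longleftrightarrow>
     distributive_ext
       (residual_map S Q ` carrier (residue_field (S\<lparr>carrier := R\<rparr>) (Q \<inter> R)))
       (residue_field S Q)"

end

theory Submission
  imports Defs
begin

text \<open>
  Let \<open>Q\<close> be a prime ideal of \<open>S\<close> and let \<open>\<phi>\<close> be the map from \<open>S\<close> to its residue field at \<open>Q\<close>.
  The intermediate rings of \<open>R \<subseteq> S\<close> are compared with those of the residual extension by sending
  \<open>A\<close> to \<open>frac_image A\<close>, the set of all \<open>\<phi> a / \<phi> u\<close> with \<open>a \<in> A\<close> and \<open>u \<in> R - Q\<close>.  By integrality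
  every element of the residue field is a fraction with a denominator in \<open>R - Q\<close>, so this map
  is surjective, with the preimage under \<open>\<phi>\<close> as a section.  It commutes with composita
  (\<open>frac_image_compositum\<close>), and \<open>frac_image (T \<inter> U)\<close> is the intersection of the images
  as soon as every element of \<open>Q\<close> is carried into \<open>U\<close> by some factor in \<open>R - Q\<close>
  (\<open>frac_image_Int\<close>).

  Suppose that \<open>R \<subseteq> S\<close> is distributive.  Preimages of intermediate rings of the residual extension
  contain \<open>Q\<close>, so both operations are compatible with \<open>frac_image\<close> there and the distributive
  law passes to the residual extension.

  For the converse the essential point is \<open>prime_locally_in_base\<close>: every \<open>q \<in> Q\<close> has a multiple
  \<open>u q \<in> R\<close> with \<open>u \<in> R - Q\<close>.  In other words, after localization at \<open>Q \<inter> R\<close> the prime \<open>Q\<close> is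
  contained in \<open>R\<close>.  It follows that \<open>frac_image\<close> commutes with all intersections, and that for
  \<open>x \<in> T \<inter> U V\<close> distributivity of the residual extension yields \<open>u \<in> R - Q\<close> with
  \<open>u x \<in> (T \<inter> U) (T \<inter> V)\<close>.  Hence the ideal of all \<open>r \<in> R\<close> with \<open>r x \<in> (T \<inter> U) (T \<inter> V)\<close> lies in no
  prime ideal of \<open>S\<close>; by lying over it contains \<open>1\<close>.

  The essential point has two halves; both use that FCP makes decreasing sequences of
  intermediate rings stationary.
  \<^item> If \<open>m \<in> Q \<inter> R\<close> then \<open>m S\<close> is locally contained in \<open>R\<close> (\<open>multiples_locally_in_base\<close>).  Given
    \<open>s \<in> S\<close>, integrality yields a subring \<open>B\<close> with \<open>s \<in> B\<close> that is spanned over \<open>R\<close> by finitely many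
    powers of \<open>s\<close>.  The rings \<open>R + m\<^sup>k B\<close> are locally stationary, so Nakayama's argument
    gives \<open>m\<^sup>k B \<subseteq> R\<close> locally for some \<open>k\<close>.  An
    element \<open>x\<close> with \<open>x\<^sup>2\<close> and \<open>x\<^sup>3\<close> in \<open>R\<close> lies in \<open>R\<close> by t-closedness, and this lowers the exponent
    to \<open>1\<close>.
  \<^item> For \<open>q \<in> Q\<close> the rings \<open>R + q\<^sup>k S\<close> are locally stationary, so \<open>u q\<^sup>k = r + q\<^sup>2\<^sup>k c\<close> for some
    \<open>u \<in> R - Q\<close> and \<open>r \<in> R\<close>.  Then \<open>e = q\<^sup>k c\<close> is an idempotent up to the factor \<open>u\<close> and an error from
    \<open>r S\<close>, namely \<open>e\<^sup>2 - u e = - r c\<close>, and \<open>r \<in> Q \<inter> R\<close>.  By the first half and t-closedness, \<open>e\<close> lies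
    in \<open>R\<close> locally; so does \<open>q\<^sup>k\<close>, and finally \<open>q\<close>.
\<close>

section \<open>Subrings, saturation and decreasing chains\<close>

text \<open>
  For \<open>D\<close> multiplicatively closed, this is the preimage in \<open>S\<close> of the localization of \<open>N\<close> at \<open>D\<close>.
  Working with it lets local statements be made about elements of \<open>S\<close> itself.
\<close>
definition saturation :: "('a, 'b) ring_scheme \<Rightarrow> 'a set \<Rightarrow> 'a set \<Rightarrow> 'a set" where
  "saturation S D N = {s \<in> carrier S. \<exists>u\<in>D. u \<otimes>\<^bsub>S\<^esub> s \<in> N}"

locale ring_ext = cring S for S (structure) +
  fixes R :: "'a set"
  assumes subring: "subring R S"
begin

lemma R_carrier: "r \<in> R \<Longrightarrow> r \<in> carrier S"
  using subringE(1)[OF subring] by blast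

lemmas R_zero = subringE(2)[OF subring]
lemmas R_one = subringE(3)[OF subring]
lemmas R_neg = subringE(5)[OF subring]
lemmas R_mult = subringE(6)[OF subring]
lemmas R_add = subringE(7)[OF subring]

lemma R_minus: "\<lbrakk>a \<in> R; b \<in> R\<rbrakk> \<Longrightarrow> a \<ominus> b \<in> R"
  by (simp add: a_minus_def R_add R_neg)

lemma R_pow: "r \<in> R \<Longrightarrow> r [^] (n::nat) \<in> R"
  by (induction n) (simp_all add: R_one R_mult)

end

locale ring_ext_denominators = ring_ext +
  fixes D :: "'a set"
  assumes D_submonoid: "submonoid D S" and D_sub_R: "D \<subseteq> R"
begin

lemma D_one: "\<one> \<in> D"
  using D_submonoid by (simp add: submonoid.one_closed)

lemma D_mult: "\<lbrakk>u \<in> D; v \<in> D\<rbrakk> \<Longrightarrow> u \<otimes> v \<in> D"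
  using D_submonoid by (simp add: submonoid.m_closed)

lemma D_R: "u \<in> D \<Longrightarrow> u \<in> R"
  using D_sub_R by blast

lemma D_carrier: "u \<in> D \<Longrightarrow> u \<in> carrier S"
  by (simp add: D_R R_carrier)

abbreviation sat :: "'a set \<Rightarrow> 'a set" where
  "sat \<equiv> saturation S D"

lemma saturation_extensive:
  assumes "N \<subseteq> carrier S" shows "N \<subseteq> sat N"
  using assms D_one by (auto simp: saturation_def intro!: bexI[of _ "\<one>"])

lemma saturation_mono: "N \<subseteq> N' \<Longrightarrow> sat N \<subseteq> sat N'"
  by (auto simp: saturation_def)

lemma saturation_cancel:
  assumes "u \<in> D" "u \<otimes> s \<in> sat N" "s \<in> carrier S"
  shows "s \<in> sat N"
proof -
  obtain v where v: "v \<in> D" "v \<otimes> (u \<otimes> s) \<in> N"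
    using assms(2) by (auto simp: saturation_def)
  then have "(v \<otimes> u) \<otimes> s \<in> N"
    using assms D_carrier v(1) by (simp add: m_assoc)
  then show ?thesis
    using v(1) assms D_mult by (auto simp: saturation_def)
qed

lemma saturation_subring:
  assumes N: "subring N S" and RN: "R \<subseteq> N"
  shows "subring (sat N) S"
proof (rule subringI)
  note NE = subringE(2,3,5,6,7)[OF N]
  have Nc: "x \<in> N \<Longrightarrow> x \<in> carrier S" for x
    using subringE(1)[OF N] by blast
  show "sat N \<subseteq> carrier S" by (auto simp: saturation_def)
  show "\<one> \<in> sat N" using saturation_extensive[of N] Nc NE(2) by blast
  show "\<ominus> h \<in> sat N" if h: "h \<in> sat N" for h
  proof -
    obtain u where u: "u \<in> D" "u \<otimes> h \<in> N" "h \<in> carrier S" using h by (auto simp: saturation_def)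
    then have "u \<otimes> (\<ominus> h) \<in> N" using NE(3) D_carrier by (metis r_minus)
    then show ?thesis using u by (auto simp: saturation_def)
  qed
  fix x y assume "x \<in> sat N" "y \<in> sat N"
  then obtain u v where uv: "x \<in> carrier S" "u \<in> D" "u \<otimes> x \<in> N" "y \<in> carrier S" "v \<in> D" "v \<otimes> y \<in> N"
    by (auto simp: saturation_def)
  have uvN: "u \<in> N" "v \<in> N" using uv RN D_R by auto
  have c: "u \<in> carrier S" "v \<in> carrier S" using uvN Nc by auto
  have "(u \<otimes> v) \<otimes> (x \<otimes> y) = (u \<otimes> x) \<otimes> (v \<otimes> y)"
    using uv(1,4) c by algebra
  then have "(u \<otimes> v) \<otimes> (x \<otimes> y) \<in> N" using NE(4) uv by simp
  then show "x \<otimes> y \<in> sat N" using uv D_mult by (auto simp: saturation_def)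
  have "(u \<otimes> v) \<otimes> (x \<oplus> y) = v \<otimes> (u \<otimes> x) \<oplus> u \<otimes> (v \<otimes> y)"
    using uv(1,4) c by algebra
  then have "(u \<otimes> v) \<otimes> (x \<oplus> y) \<in> N" using NE(4,5) uv uvN by simp
  then show "x \<oplus> y \<in> sat N" using uv D_mult by (auto simp: saturation_def)
qed

text \<open>
  If \<open>b\<close> and \<open>r\<close> satisfy the relations of t-closedness up to denominators, then so do \<open>d b\<close> and \<open>d r\<close>
  over \<open>R\<close> for a common denominator \<open>d\<close>, because the relations are homogeneous in \<open>(b, r)\<close>.
\<close>
lemma t_closed_saturation:
  assumes t: "t_closed_ext R S"
  shows "t_closed_ext (sat R) S"
  unfolding t_closed_ext_def
proof (intro ballI impI)
  fix b r assume b: "b \<in> carrier S" and r: "r \<in> sat R"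
    and 2: "b [^] (2::nat) \<ominus> r \<otimes> b \<in> sat R"
    and 3: "b [^] (3::nat) \<ominus> r \<otimes> b [^] (2::nat) \<in> sat R"
  obtain u where u: "u \<in> D" "u \<otimes> r \<in> R" and rc: "r \<in> carrier S"
    using r by (auto simp: saturation_def)
  obtain v where v: "v \<in> D" "v \<otimes> (b [^] (2::nat) \<ominus> r \<otimes> b) \<in> R"
    using 2 by (auto simp: saturation_def)
  obtain w where w: "w \<in> D" "w \<otimes> (b [^] (3::nat) \<ominus> r \<otimes> b [^] (2::nat)) \<in> R"
    using 3 by (auto simp: saturation_def)
  define d where "d = u \<otimes> v \<otimes> w"
  have d: "d \<in> D" using u v w by (simp add: d_def D_mult)
  have c [simp]: "u \<in> carrier S" "v \<in> carrier S" "w \<in> carrier S" "d \<in> carrier S"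
    using u v w d D_carrier by auto
  have p2: "x [^] (2::nat) = x \<otimes> x" if "x \<in> carrier S" for x
    using that by (simp add: numeral_2_eq_2)
  have p3: "x [^] (3::nat) = x \<otimes> x \<otimes> x" if "x \<in> carrier S" for x
    using that by (simp add: numeral_3_eq_3)
  have clear: "d \<otimes> x \<in> R" if "x \<in> carrier S" "e \<in> {u, v, w}" "e \<otimes> x \<in> R" for e x
  proof -
    have "d \<otimes> x = (v \<otimes> w) \<otimes> (u \<otimes> x)" "d \<otimes> x = (u \<otimes> w) \<otimes> (v \<otimes> x)" "d \<otimes> x = (u \<otimes> v) \<otimes> (w \<otimes> x)"
      unfolding d_def using c(1-3) that(1) by algebra+
    moreover have "u \<otimes> v \<in> R" "u \<otimes> w \<in> R" "v \<otimes> w \<in> R" using u(1) v(1) w(1) by (simp_all add: D_R R_mult)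
    ultimately show ?thesis using that(2,3) R_mult by (metis insertE singletonD)
  qed
  have e1R: "d \<otimes> r \<in> R" using clear[of r u] u rc by simp
  have bc: "b [^] (2::nat) \<ominus> r \<otimes> b \<in> carrier S" "b [^] (3::nat) \<ominus> r \<otimes> b [^] (2::nat) \<in> carrier S"
    using b rc by simp_all
  have b2: "d \<otimes> (d \<otimes> (b [^] (2::nat) \<ominus> r \<otimes> b)) \<in> R"
    using clear[OF bc(1), of v] v(2) d by (simp add: D_R R_mult)
  have b3: "d \<otimes> (d \<otimes> (d \<otimes> (b [^] (3::nat) \<ominus> r \<otimes> b [^] (2::nat)))) \<in> R"
    using clear[OF bc(2), of w] w(2) d by (simp add: D_R R_mult)
  have e2: "(d \<otimes> b) [^] (2::nat) \<ominus> (d \<otimes> r) \<otimes> (d \<otimes> b)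
      = d \<otimes> (d \<otimes> (b [^] (2::nat) \<ominus> r \<otimes> b))"
    unfolding p2[OF b] p2[OF m_closed[OF c(4) b]] using b rc c(4) by algebra
  have e3: "(d \<otimes> b) [^] (3::nat) \<ominus> (d \<otimes> r) \<otimes> (d \<otimes> b) [^] (2::nat)
      = d \<otimes> (d \<otimes> (d \<otimes> (b [^] (3::nat) \<ominus> r \<otimes> b [^] (2::nat))))"
    unfolding p2[OF b] p3[OF b] p2[OF m_closed[OF c(4) b]] p3[OF m_closed[OF c(4) b]]
    using b rc c(4) by algebra
  have "d \<otimes> b \<in> R"
    using t[unfolded t_closed_ext_def, rule_format, of "d \<otimes> b" "d \<otimes> r"]
    unfolding e2 e3 using e1R b2 b3 b c by auto
  then show "b \<in> sat R" using b d by (auto simp: saturation_def)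
qed

end

lemma FCP_decreasing_stable:
  assumes "FCP_ext R S"
    and f: "\<And>n. f n \<in> intermediate_rings R S"
    and dec: "\<And>n. f (Suc n) \<subseteq> f n"
  obtains k where "\<And>j. k \<le> j \<Longrightarrow> f j = f k"
proof -
  have anti: "f j \<subseteq> f i" if "i \<le> j" for i j
    using that by (induction j rule: dec_induct) (use dec in blast)+
  have "subset.chain (intermediate_rings R S) (range f)"
    unfolding subset_chain_def
  proof (intro conjI ballI)
    show "range f \<subseteq> intermediate_rings R S" using f by blast
    fix C C' assume "C \<in> range f" "C' \<in> range f"
    then obtain i j where "C = f i" "C' = f j" by blast
    then show "C \<subseteq> C' \<or> C' \<subseteq> C" using anti[of i j] anti[of j i] linear[of i j] by auto
  qed
  then have "finite (range f)"
    using assms(1) by (auto simp: FCP_ext_def)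
  then have "\<exists>m\<in>range f. \<forall>x\<in>range f. x \<subseteq> m \<longrightarrow> m = x"
    by (rule finite_has_minimal) simp
  then obtain k where k: "\<forall>x\<in>range f. x \<subseteq> f k \<longrightarrow> f k = x" by (elim bexE imageE) simp
  have "f j = f k" if "k \<le> j" for j
    using k[rule_format, OF rangeI anti[OF that]] by (rule sym)
  then show ?thesis by (rule that)
qed

context ring_ext
begin

lemma subring_plus_multiples:
  assumes B: "subring B S" and RB: "R \<subseteq> B" and z: "z \<in> B"
  shows "subring {r \<oplus> z \<otimes> b |r b. r \<in> R \<and> b \<in> B} S"
    (is "subring ?C S")
proof (rule subringI)
  note BE = subringE(2,3,5,6,7)[OF B]
  have Bc: "x \<in> B \<Longrightarrow> x \<in> carrier S" for x
    using subringE(1)[OF B] by blast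
  have zc: "z \<in> carrier S" using z Bc by blast
  show "?C \<subseteq> carrier S" using zc Bc R_carrier by auto
  have "\<one> = \<one> \<oplus> z \<otimes> \<zero>" using zc by simp
  then show "\<one> \<in> ?C" using R_one BE(1) by blast
  show "\<ominus> h \<in> ?C" if h: "h \<in> ?C" for h
  proof -
    obtain r b where rb: "h = r \<oplus> z \<otimes> b" "r \<in> R" "b \<in> B" using h by blast
    have "\<ominus> h = \<ominus> r \<oplus> z \<otimes> (\<ominus> b)"
      unfolding rb(1) using R_carrier[OF rb(2)] Bc[OF rb(3)] zc by algebra
    then show ?thesis using R_neg[OF rb(2)] BE(3)[OF rb(3)] by blast
  qed
  fix h h' assume "h \<in> ?C" "h' \<in> ?C"
  then obtain r b r' b' where rb: "h = r \<oplus> z \<otimes> b" "r \<in> R" "b \<in> B" "h' = r' \<oplus> z \<otimes> b'" "r' \<in> R" "b' \<in> B"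
    by blast
  have c: "r \<in> carrier S" "r' \<in> carrier S" "b \<in> carrier S" "b' \<in> carrier S"
    using rb Bc R_carrier by auto
  have "h \<oplus> h' = (r \<oplus> r') \<oplus> z \<otimes> (b \<oplus> b')"
    unfolding rb(1,4) using c zc by algebra
  then show "h \<oplus> h' \<in> ?C" using R_add[OF rb(2,5)] BE(5)[OF rb(3,6)] by blast
  have "h \<otimes> h' = r \<otimes> r' \<oplus> z \<otimes> (r \<otimes> b' \<oplus> r' \<otimes> b \<oplus> z \<otimes> (b \<otimes> b'))"
    unfolding rb(1,4) using c zc by algebra
  moreover have "r \<otimes> b' \<oplus> r' \<otimes> b \<oplus> z \<otimes> (b \<otimes> b') \<in> B"
    using rb z RB by (simp add: BE subsetD)
  ultimately show "h \<otimes> h' \<in> ?C" using R_mult[OF rb(2,5)] by blast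
qed

end

context ring_ext_denominators
begin

text \<open>
  The saturations of the rings \<open>R + z\<^sup>k B\<close> decrease with \<open>k\<close>, so FCP makes them stationary.
\<close>
lemma FCP_power_multiples:
  assumes FCP: "FCP_ext R S" and B: "subring B S" and RB: "R \<subseteq> B" and z: "z \<in> B"
  obtains k0 :: nat where "\<And>k i b. \<lbrakk>k0 \<le> k; k \<le> i; b \<in> B\<rbrakk> \<Longrightarrow>
    \<exists>u\<in>D. \<exists>r\<in>R. \<exists>c\<in>B. u \<otimes> (z [^] k \<otimes> b) = r \<oplus> z [^] i \<otimes> c"
proof -
  note BE = subringE(2,3,5,6,7)[OF B]
  have Bc: "x \<in> B \<Longrightarrow> x \<in> carrier S" for x
    using subringE(1)[OF B] by blast
  have zc: "z \<in> carrier S" using z Bc by blast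
  have zp: "z [^] (n::nat) \<in> B" for n by (induction n) (simp_all add: BE z)
  define C where "C n = {r \<oplus> z [^] n \<otimes> b |r b. r \<in> R \<and> b \<in> B}" for n :: nat
  have Csub: "subring (C n) S" for n
    unfolding C_def by (rule subring_plus_multiples[OF B RB zp])
  have RC: "R \<subseteq> C n" for n
  proof
    fix r assume "r \<in> R"
    moreover from this have "r = r \<oplus> z [^] n \<otimes> \<zero>" using zc R_carrier by simp
    ultimately show "r \<in> C n" unfolding C_def using BE(1) by blast
  qed
  have Cdec: "C (Suc n) \<subseteq> C n" for n
  proof
    fix x assume "x \<in> C (Suc n)"
    then obtain r b where "x = r \<oplus> z [^] (Suc n) \<otimes> b" "r \<in> R" "b \<in> B" unfolding C_def by blast
    then have "x = r \<oplus> z [^] n \<otimes> (z \<otimes> b)" "r \<in> R" "z \<otimes> b \<in> B" using z zc Bc BE(4) by (auto simp: m_assoc)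
    then show "x \<in> C n" unfolding C_def by blast
  qed
  have "sat (C n) \<in> intermediate_rings R S" for n
    using saturation_subring[OF Csub RC] saturation_extensive[of "C n"] RC[of n] subringE(1)[OF Csub[of n]]
    by (auto simp: intermediate_rings_def)
  then obtain k0 where k0: "\<And>j. k0 \<le> j \<Longrightarrow> sat (C j) = sat (C k0)"
    using FCP_decreasing_stable[OF FCP, of "\<lambda>n. sat (C n)"] saturation_mono[OF Cdec] by metis
  show ?thesis
  proof (rule that)
    fix k i b assume ki: "k0 \<le> k" "k \<le> i" and b: "b \<in> B"
    have "z [^] k \<otimes> b \<in> C k"
    proof -
      have "z [^] k \<otimes> b = \<zero> \<oplus> z [^] k \<otimes> b" using zc Bc b by simp
      then show ?thesis unfolding C_def using R_zero b by blast
    qed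
    then have "z [^] k \<otimes> b \<in> sat (C i)"
      using saturation_extensive[of "C k"] subringE(1)[OF Csub[of k]] k0[of k] k0[of i] ki by auto
    then show "\<exists>u\<in>D. \<exists>r\<in>R. \<exists>c\<in>B. u \<otimes> (z [^] k \<otimes> b) = r \<oplus> z [^] i \<otimes> c"
      unfolding saturation_def C_def by blast
  qed
qed

end

section \<open>Algebras generated by one integral element\<close>

text \<open>
  The \<open>R\<close>-module spanned by \<open>1, g, \<dots>, g\<^sup>n\<^sup>-\<^sup>1\<close>.  Building it one power at a time gives the
  descending induction of the Nakayama argument below its shape.
\<close>
primrec power_span :: "('a, 'b) ring_scheme \<Rightarrow> 'a set \<Rightarrow> 'a \<Rightarrow> nat \<Rightarrow> 'a set" where
  "power_span S R g 0 = {\<zero>\<^bsub>S\<^esub>}"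
| "power_span S R g (Suc n) =
    {l \<oplus>\<^bsub>S\<^esub> r \<otimes>\<^bsub>S\<^esub> g [^]\<^bsub>S\<^esub> n |l r. l \<in> power_span S R g n \<and> r \<in> R}"

context ring_ext
begin

abbreviation span :: "'a \<Rightarrow> nat \<Rightarrow> 'a set" where "span \<equiv> power_span S R"

lemma power_span_SucI:
  "\<lbrakk>l \<in> span g n; r \<in> R\<rbrakk> \<Longrightarrow> l \<oplus> r \<otimes> g [^] n \<in> span g (Suc n)"
  by auto

lemma power_span_carrier:
  assumes g: "g \<in> carrier S" shows "l \<in> span g n \<Longrightarrow> l \<in> carrier S"
  by (induction n arbitrary: l) (use g R_carrier in auto)

lemma power_span_zero:
  assumes g: "g \<in> carrier S" shows "\<zero> \<in> span g n"
proof (induction n)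
  case (Suc n)
  have "\<zero> = \<zero> \<oplus> \<zero> \<otimes> g [^] n" using g by simp
  then show ?case using power_span_SucI[OF Suc R_zero] by metis
qed simp

lemma power_span_add:
  assumes g: "g \<in> carrier S"
  shows "\<lbrakk>l \<in> span g n; l' \<in> span g n\<rbrakk> \<Longrightarrow> l \<oplus> l' \<in> span g n"
proof (induction n arbitrary: l l')
  case (Suc n)
  obtain m r m' r' where m: "l = m \<oplus> r \<otimes> g [^] n" "m \<in> span g n" "r \<in> R"
      "l' = m' \<oplus> r' \<otimes> g [^] n" "m' \<in> span g n" "r' \<in> R"
    using Suc.prems by auto
  have "l \<oplus> l' = (m \<oplus> m') \<oplus> (r \<oplus> r') \<otimes> g [^] n"
    unfolding m(1,4) using m(3,6)[THEN R_carrier] m(2,5)[THEN power_span_carrier[OF g]] nat_pow_closed[OF g, of n]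
    by algebra
  then show ?case using power_span_SucI[OF Suc.IH[OF m(2,5)] R_add[OF m(3,6)]] by metis
qed simp

lemma power_span_smult:
  assumes g: "g \<in> carrier S" and a: "a \<in> R"
  shows "l \<in> span g n \<Longrightarrow> a \<otimes> l \<in> span g n"
proof (induction n arbitrary: l)
  case 0 then show ?case using R_carrier[OF a] by simp
next
  case (Suc n)
  obtain m r where m: "l = m \<oplus> r \<otimes> g [^] n" "m \<in> span g n" "r \<in> R"
    using Suc.prems by auto
  have "a \<otimes> l = a \<otimes> m \<oplus> (a \<otimes> r) \<otimes> g [^] n"
    unfolding m(1) using R_carrier[OF m(3)] R_carrier[OF a] power_span_carrier[OF g m(2)] nat_pow_closed[OF g, of n]
    by algebra
  then show ?case using power_span_SucI[OF Suc.IH[OF m(2)] R_mult[OF a m(3)]] by metis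
qed

lemma power_span_neg:
  assumes g: "g \<in> carrier S" and l: "l \<in> span g n"
  shows "\<ominus> l \<in> span g n"
  using power_span_smult[OF g R_neg[OF R_one] l] power_span_carrier[OF g l] by (simp add: l_minus)

lemma power_span_Suc:
  assumes g: "g \<in> carrier S" and l: "l \<in> span g n"
  shows "l \<in> span g (Suc n)"
proof -
  have "l = l \<oplus> \<zero> \<otimes> g [^] n" using g power_span_carrier[OF g l] by simp
  then show ?thesis using power_span_SucI[OF l R_zero] by metis
qed

lemma power_in_power_span:
  assumes g: "g \<in> carrier S"
  shows "g [^] n \<in> span g (Suc n)"
proof -
  have "g [^] n = \<zero> \<oplus> \<one> \<otimes> g [^] n" using g by simp
  then show ?thesis using power_span_SucI[OF power_span_zero[OF g] R_one] by metis
qed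

lemma power_span_shift:
  assumes g: "g \<in> carrier S"
  shows "l \<in> span g n \<Longrightarrow> g \<otimes> l \<in> span g (Suc n)"
proof (induction n arbitrary: l)
  case 0 then show ?case using power_span_zero[OF g, of 1] g by simp
next
  case (Suc n)
  obtain m r where m: "l = m \<oplus> r \<otimes> g [^] n" "m \<in> span g n" "r \<in> R"
    using Suc.prems by auto
  have "g \<otimes> l = g \<otimes> m \<oplus> r \<otimes> (g [^] n \<otimes> g)"
    unfolding m(1) using R_carrier[OF m(3)] power_span_carrier[OF g m(2)] nat_pow_closed[OF g, of n] g
    by algebra
  then show ?case using power_span_SucI[OF Suc.IH[OF m(2)] m(3)] by simp
qed

lemma one_in_power_span:
  assumes g: "g \<in> carrier S"
  shows "\<one> \<in> span g (Suc n)"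
proof (induction n)
  case 0 show ?case using power_in_power_span[OF g, of 0] by simp
qed (rule power_span_Suc[OF g])

lemma eval_in_power_span:
  assumes g: "g \<in> carrier S"
  shows "set p \<subseteq> R \<Longrightarrow> eval p g \<in> span g (length p)"
proof (induction p)
  case (Cons a p)
  have a: "a \<in> R" and p: "eval p g \<in> span g (length p)" using Cons by simp_all
  have "eval p g \<in> carrier S" by (rule power_span_carrier[OF g p])
  then have "eval (a # p) g = eval p g \<oplus> a \<otimes> g [^] length p"
    using g R_carrier[OF a] by (simp add: a_comm)
  then show ?case using power_span_SucI[OF p a] by simp
qed simp

text \<open>
  An integral equation of degree \<open>n\<close> puts \<open>g\<^sup>n\<close> into the span of the lower powers, which is then stable
  under multiplication by \<open>g\<close>.  The multipliers of this module form a ring, and contain \<open>g\<close> and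
  \<open>R\<close>; they lie in the module because it contains \<open>1\<close>.
\<close>
lemma integral_element_in_finite_subring:
  assumes int: "integral_ext R S" and g: "g \<in> carrier S"
  obtains B n where "subring B S" "R \<subseteq> B" "g \<in> B" "B \<subseteq> span g n"
proof -
  obtain p where p: "set p \<subseteq> R" "eval (\<one> # p) g = \<zero>"
    using int g unfolding integral_ext_def by blast
  have ep: "eval p g \<in> span g (length p)" "eval p g \<in> carrier S"
    using eval_in_power_span[OF g p(1)] power_span_carrier[OF g] by auto
  have "g [^] length p \<oplus> eval p g = \<zero>"
    using p(2) g by simp
  then have "g [^] length p = \<ominus> eval p g"
    using ep g by (metis minus_equality nat_pow_closed)
  then have "g [^] length p \<in> span g (length p)"
    using power_span_neg[OF g ep(1)] by simp
  \<comment> \<open>One power more than the degree, so that \<open>1\<close> lies in the span even when \<open>p\<close> is empty.\<close>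
  define n where "n = Suc (length p)"
  have gn: "g [^] n \<in> span g n"
    using power_span_shift[OF g \<open>g [^] length p \<in> span g (length p)\<close>] g
    by (simp add: n_def m_comm del: power_span.simps)
  let ?L = "span g n"
  note Lc = power_span_carrier[OF g, of _ n]
  define B where "B = {b \<in> carrier S. \<forall>l\<in>?L. b \<otimes> l \<in> ?L}"
  have Bsub: "subring B S"
  proof (rule subringI)
    show "B \<subseteq> carrier S" "\<one> \<in> B" using Lc by (auto simp: B_def)
    show "\<ominus> h \<in> B" if "h \<in> B" for h
      using that power_span_neg[OF g, of _ n] Lc by (auto simp: B_def l_minus)
    fix h h' assume h: "h \<in> B" "h' \<in> B"
    show "h \<otimes> h' \<in> B" using h Lc by (auto simp: B_def m_assoc)
    show "h \<oplus> h' \<in> B" using h power_span_add[OF g, of _ n] Lc by (auto simp: B_def l_distr)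
  qed
  have RB: "R \<subseteq> B" using power_span_smult[OF g] R_carrier by (auto simp: B_def)
  have "g \<otimes> l \<in> ?L" if l: "l \<in> ?L" for l
  proof -
    obtain m r where m: "g \<otimes> l = m \<oplus> r \<otimes> g [^] n" "m \<in> ?L" "r \<in> R"
      using power_span_shift[OF g l] by auto
    then show ?thesis using power_span_add[OF g] power_span_smult[OF g] gn by simp
  qed
  then have gB: "g \<in> B" using g by (auto simp: B_def)
  have one: "\<one> \<in> ?L" unfolding n_def by (rule one_in_power_span[OF g])
  have "B \<subseteq> ?L"
  proof
    fix b assume "b \<in> B"
    then have "b \<otimes> \<one> \<in> ?L" "b \<in> carrier S" using one by (auto simp: B_def)
    then show "b \<in> ?L" by simp
  qed
  with Bsub RB gB show ?thesis by (rule that)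
qed

end

context ring_ext_denominators
begin

text \<open>
  Nakayama's lemma for the module \<open>(R + z B) / R\<close>, localized at \<open>D\<close>: stationarity says that \<open>m\<close>
  reproduces it.  The generators \<open>z g\<^sup>n\<^sup>-\<^sup>1, \<dots>, z\<close> are eliminated in this order: a relation
  expresses \<open>z g\<^sup>j\<close> by lower ones and \<open>a m z g\<^sup>j\<close>, and \<open>w = v u - a m\<close> is still a denominator.
\<close>
lemma nakayama_power_span:
  assumes g: "g \<in> carrier S" and B: "subring B S" "R \<subseteq> B" "g \<in> B" "B \<subseteq> span g n"
    and m: "m \<in> R" and Dm: "\<And>u r. \<lbrakk>u \<in> D; r \<in> R\<rbrakk> \<Longrightarrow> u \<ominus> r \<otimes> m \<in> D"
    and z: "z \<in> carrier S"
    and stable: "\<And>b. b \<in> B \<Longrightarrow> \<exists>u\<in>D. \<exists>r\<in>R. \<exists>c\<in>B. u \<otimes> (z \<otimes> b) = r \<oplus> (m \<otimes> z) \<otimes> c"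
    and b: "b \<in> B"
  shows "z \<otimes> b \<in> sat R"
proof -
  note BE = subringE(2,3,5,6,7)[OF B(1)]
  have Bc: "x \<in> B \<Longrightarrow> x \<in> carrier S" for x
    using subringE(1)[OF B(1)] by blast
  have gp: "g [^] (i::nat) \<in> B" for i by (induction i) (simp_all add: BE B)
  \<comment> \<open>Downward from \<open>j = n\<close>: up to denominators, \<open>z B\<close> is contained in \<open>R\<close> plus \<open>z\<close> times the span of the
    first \<open>j\<close> powers.  At \<open>j = 0\<close> this is the claim.\<close>
  have "j \<le> n \<Longrightarrow> \<forall>b\<in>B. \<exists>u\<in>D. \<exists>r\<in>R. \<exists>l\<in>span g j. u \<otimes> (z \<otimes> b) = r \<oplus> z \<otimes> l" for j
  proof (induction j rule: inc_induct)
    case base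
    show ?case
    proof
      fix b assume b: "b \<in> B"
      then have "\<one> \<otimes> (z \<otimes> b) = \<zero> \<oplus> z \<otimes> b" using z Bc by simp
      then show "\<exists>u\<in>D. \<exists>r\<in>R. \<exists>l\<in>span g n. u \<otimes> (z \<otimes> b) = r \<oplus> z \<otimes> l"
        using D_one R_zero B(4) b by blast
    qed
  next
    case (step j)
    define h where "h = g [^] j"
    have hB: "h \<in> B" and hc: "h \<in> carrier S" unfolding h_def using gp g by auto
    have IH: "\<exists>u\<in>D. \<exists>r\<in>R. \<exists>l\<in>span g j. \<exists>a\<in>R. u \<otimes> (z \<otimes> b) = r \<oplus> z \<otimes> (l \<oplus> a \<otimes> h)"
      if "b \<in> B" for b
      using step.IH that unfolding h_def by fastforce
    obtain u r c where u: "u \<in> D" "r \<in> R" "c \<in> B" "u \<otimes> (z \<otimes> h) = r \<oplus> (m \<otimes> z) \<otimes> c"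
      using stable[OF hB] by blast
    obtain v r' l a where v: "v \<in> D" "r' \<in> R" "l \<in> span g j" "a \<in> R" "v \<otimes> (z \<otimes> c) = r' \<oplus> z \<otimes> (l \<oplus> a \<otimes> h)"
      using IH[OF u(3)] by blast
    define w where "w = v \<otimes> u \<ominus> a \<otimes> m"
    have w: "w \<in> D" unfolding w_def using Dm u v D_mult by blast
    have wc: "w \<in> carrier S" using D_carrier[OF w] .
    have car: "u \<in> carrier S" "r \<in> carrier S" "c \<in> carrier S" "v \<in> carrier S" "r' \<in> carrier S"
       "l \<in> carrier S" "a \<in> carrier S" "m \<in> carrier S"
      using u v m R_carrier D_carrier Bc power_span_carrier[OF g] by auto
    have "w \<otimes> (z \<otimes> h) = v \<otimes> (u \<otimes> (z \<otimes> h)) \<ominus> a \<otimes> m \<otimes> (z \<otimes> h)"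
      unfolding w_def using car z hc by algebra
    also have "\<dots> = v \<otimes> r \<oplus> m \<otimes> (v \<otimes> (z \<otimes> c)) \<ominus> a \<otimes> m \<otimes> (z \<otimes> h)"
      unfolding u(4) using car z hc by algebra
    also have "\<dots> = (v \<otimes> r \<oplus> m \<otimes> r') \<oplus> z \<otimes> (m \<otimes> l)"
      unfolding v(5) using car z hc by algebra
    finally have wzh: "w \<otimes> (z \<otimes> h) = (v \<otimes> r \<oplus> m \<otimes> r') \<oplus> z \<otimes> (m \<otimes> l)" .
    define r1 where "r1 = v \<otimes> r \<oplus> m \<otimes> r'"
    define l1 where "l1 = m \<otimes> l"
    have r1: "r1 \<in> R" unfolding r1_def using u v m D_R R_mult R_add by simp
    have l1: "l1 \<in> span g j" unfolding l1_def using power_span_smult[OF g m v(3)] .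
    show ?case
    proof
      fix b assume b: "b \<in> B"
      obtain u' s k e where u': "u' \<in> D" "s \<in> R" "k \<in> span g j" "e \<in> R" "u' \<otimes> (z \<otimes> b) = s \<oplus> z \<otimes> (k \<oplus> e \<otimes> h)"
        using IH[OF b] by blast
      have car': "u' \<in> carrier S" "s \<in> carrier S" "k \<in> carrier S" "e \<in> carrier S" "b \<in> carrier S"
        "r1 \<in> carrier S" "l1 \<in> carrier S"
        using u' b r1 l1 R_carrier D_carrier Bc power_span_carrier[OF g] by auto
      have "(w \<otimes> u') \<otimes> (z \<otimes> b) = w \<otimes> (u' \<otimes> (z \<otimes> b))"
        using car' z wc by algebra
      also have "\<dots> = w \<otimes> s \<oplus> z \<otimes> (w \<otimes> k) \<oplus> e \<otimes> (w \<otimes> (z \<otimes> h))"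
        unfolding u'(5) using car' z wc hc by algebra
      also have "\<dots> = (w \<otimes> s \<oplus> e \<otimes> r1) \<oplus> z \<otimes> (w \<otimes> k \<oplus> e \<otimes> l1)"
        unfolding wzh r1_def[symmetric] l1_def[symmetric] using car' z wc hc by algebra
      finally have "(w \<otimes> u') \<otimes> (z \<otimes> b) = (w \<otimes> s \<oplus> e \<otimes> r1) \<oplus> z \<otimes> (w \<otimes> k \<oplus> e \<otimes> l1)" .
      moreover have "w \<otimes> u' \<in> D" "w \<otimes> s \<oplus> e \<otimes> r1 \<in> R" "w \<otimes> k \<oplus> e \<otimes> l1 \<in> span g j"
        using w u' r1 l1 D_mult D_R R_mult R_add power_span_add[OF g] power_span_smult[OF g] by auto
      ultimately show "\<exists>u\<in>D. \<exists>r\<in>R. \<exists>l\<in>span g j. u \<otimes> (z \<otimes> b) = r \<oplus> z \<otimes> l" by blast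
    qed
  qed
  from this[of 0] obtain u r where "u \<in> D" "r \<in> R" "u \<otimes> (z \<otimes> b) = r \<oplus> z \<otimes> \<zero>"
    using b by auto
  then show ?thesis using z Bc b R_carrier by (auto simp: saturation_def)
qed

end

section \<open>Primes of an integral t-closed FCP extension\<close>

context ring_ext_denominators
begin

lemma t_closed_saturationD:
  assumes t: "t_closed_ext R S" and x: "x \<in> carrier S"
    and x2: "x \<otimes> x \<in> sat R" and x3: "x \<otimes> x \<otimes> x \<in> sat R"
  shows "x \<in> sat R"
proof -
  have "\<zero> \<in> sat R"
    using saturation_subring[OF subring] subringE(2) by blast
  moreover have "x [^] (2::nat) \<ominus> \<zero> \<otimes> x = x \<otimes> x" "x [^] (3::nat) \<ominus> \<zero> \<otimes> x [^] (2::nat) = x \<otimes> x \<otimes> x"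
    using x by (simp_all add: numeral_2_eq_2 numeral_3_eq_3 a_minus_def)
  ultimately show ?thesis
    using t_closed_saturation[OF t] x x2 x3 unfolding t_closed_ext_def by metis
qed

text \<open>
  For \<open>k \<ge> 1\<close> the square and the cube of \<open>z\<^sup>k c\<close> are multiples of \<open>z\<^sup>k\<^sup>+\<^sup>1\<close>, so t-closedness lowers the
  exponent step by step.
\<close>
lemma t_closed_descent:
  assumes t: "t_closed_ext R S" and B: "subring B S" and z: "z \<in> B"
    and k: "\<And>b. b \<in> B \<Longrightarrow> z [^] Suc k \<otimes> b \<in> sat R" and b: "b \<in> B"
  shows "z \<otimes> b \<in> sat R"
proof -
  note BE = subringE(2,3,5,6,7)[OF B]
  have Bc: "x \<in> B \<Longrightarrow> x \<in> carrier S" for x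
    using subringE(1)[OF B] by blast
  have zp: "z [^] (i::nat) \<in> B" for i by (induction i) (simp_all add: BE z)
  have zc: "z \<in> carrier S" using z Bc by blast
  from k b show ?thesis
  proof (induction k arbitrary: b)
    case 0
    then show ?case using zc by simp
  next
    case (Suc k)
    have "z [^] Suc k \<otimes> c \<in> sat R" if c: "c \<in> B" for c
    proof (rule t_closed_saturationD[OF t])
      have cc: "c \<in> carrier S" "z [^] k \<in> carrier S" using Bc c zp by auto
      show "z [^] Suc k \<otimes> c \<in> carrier S" using cc zc by simp
      have "z [^] Suc k \<otimes> c \<otimes> (z [^] Suc k \<otimes> c) = z [^] Suc (Suc k) \<otimes> (z [^] k \<otimes> (c \<otimes> c))"
        unfolding nat_pow_Suc using cc zc by algebra
      then show "z [^] Suc k \<otimes> c \<otimes> (z [^] Suc k \<otimes> c) \<in> sat R"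
        using Suc.prems(1)[of "z [^] k \<otimes> (c \<otimes> c)"] BE(4) zp c by metis
      have "z [^] Suc k \<otimes> c \<otimes> (z [^] Suc k \<otimes> c) \<otimes> (z [^] Suc k \<otimes> c)
         = z [^] Suc (Suc k) \<otimes> (z [^] k \<otimes> (z [^] k \<otimes> (z \<otimes> (c \<otimes> (c \<otimes> c)))))"
        unfolding nat_pow_Suc using cc zc by algebra
      then show "z [^] Suc k \<otimes> c \<otimes> (z [^] Suc k \<otimes> c) \<otimes> (z [^] Suc k \<otimes> c) \<in> sat R"
        using Suc.prems(1)[of "z [^] k \<otimes> (z [^] k \<otimes> (z \<otimes> (c \<otimes> (c \<otimes> c))))"] BE(4) zp c z by metis
    qed
    then show ?case using Suc.IH Suc.prems(2) by blast
  qed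
qed

text \<open>
  The condition on \<open>D\<close> says that elements of the ideal \<open>m R\<close> may be subtracted from denominators; that is, \<open>m\<close>
  belongs to the Jacobson radical after localization, as Nakayama's lemma demands.
\<close>
lemma multiples_locally_in_base:
  assumes int: "integral_ext R S" and t: "t_closed_ext R S" and FCP: "FCP_ext R S"
    and m: "m \<in> R" and Dm: "\<And>u r. \<lbrakk>u \<in> D; r \<in> R\<rbrakk> \<Longrightarrow> u \<ominus> r \<otimes> m \<in> D"
    and s: "s \<in> carrier S"
  shows "m \<otimes> s \<in> sat R"
proof -
  obtain B n where B: "subring B S" "R \<subseteq> B" "s \<in> B" "B \<subseteq> span s n"
    using integral_element_in_finite_subring[OF int s] by blast
  have mB: "m \<in> B" using m B by blast
  obtain k0 :: nat where k0: "\<And>k i b. \<lbrakk>k0 \<le> k; k \<le> i; b \<in> B\<rbrakk> \<Longrightarrow>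
    \<exists>u\<in>D. \<exists>r\<in>R. \<exists>c\<in>B. u \<otimes> (m [^] k \<otimes> b) = r \<oplus> m [^] i \<otimes> c"
    using FCP_power_multiples[OF FCP B(1,2) mB] by blast
  have mc: "m \<in> carrier S" using R_carrier[OF m] .
  have "m [^] Suc k0 \<otimes> b \<in> sat R" if b: "b \<in> B" for b
  proof (rule nakayama_power_span[OF s B m Dm _ _ b])
    show "m [^] Suc k0 \<in> carrier S" using mc by simp
    fix c assume "c \<in> B"
    then show "\<exists>u\<in>D. \<exists>r\<in>R. \<exists>d\<in>B. u \<otimes> (m [^] Suc k0 \<otimes> c) = r \<oplus> (m \<otimes> m [^] Suc k0) \<otimes> d"
      using k0[of "Suc k0" "Suc (Suc k0)" c] mc by (simp add: m_comm)
  qed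
  then show ?thesis by (rule t_closed_descent[OF t B(1) mB _ B(3)])
qed

end

lemma (in primeideal) complement_submonoid:
  assumes "subring A R" shows "submonoid (A - I) R"
proof -
  have "\<one> \<notin> I" using one_imp_carrier I_notcarr by blast
  then show ?thesis
    using subringE(1,3,6)[OF assms] I_prime by (intro submonoid.intro) blast+
qed

context ring_ext
begin

text \<open>
  This is where t-closedness is used with a nonzero coefficient: it brings into \<open>R\<close> the element \<open>e\<close>, which
  is idempotent up to the denominator \<open>u\<close> and an error from \<open>(Q \<inter> R) S\<close>.  The statement expresses that, locally
  at \<open>Q \<inter> R\<close>, the ideal \<open>Q\<close> is contained in \<open>R\<close>.
\<close>
lemma prime_locally_in_base:
  assumes int: "integral_ext R S" and t: "t_closed_ext R S" and FCP: "FCP_ext R S"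
    and Q: "primeideal Q S" and q: "q \<in> Q"
  shows "q \<in> saturation S (R - Q) R"
proof -
  interpret Q: primeideal Q S by (rule Q)
  interpret ring_ext_denominators S R "R - Q"
    by (intro ring_ext_denominators.intro ring_ext_axioms ring_ext_denominators_axioms.intro
        Q.complement_submonoid[OF subring] Diff_subset)
  have Qc: "x \<in> Q \<Longrightarrow> x \<in> carrier S" for x by (rule Q.Icarr)
  have mult_m: "m \<otimes> s \<in> sat R" if "m \<in> R" "m \<in> Q" "s \<in> carrier S" for m s
  proof (rule multiples_locally_in_base[OF int t FCP that(1) _ that(3)])
    fix u r assume u: "u \<in> R - Q" and r: "r \<in> R"
    have rm: "r \<otimes> m \<in> Q" using Q.I_l_closed that(2) R_carrier r by blast
    have "u = (u \<ominus> r \<otimes> m) \<oplus> r \<otimes> m"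
      using u r that by (simp add: R_carrier a_minus_def a_assoc l_neg)
    then have "u \<ominus> r \<otimes> m \<notin> Q" using u rm Q.a_closed by (metis DiffD2)
    then show "u \<ominus> r \<otimes> m \<in> R - Q" using u r that R_minus R_mult by blast
  qed
  have mult_q: "y \<otimes> s \<in> sat R" if y: "y \<in> Q" "y \<in> sat R" and s: "s \<in> carrier S" for y s
  proof -
    obtain v where v: "v \<in> R - Q" "v \<otimes> y \<in> R" using y by (auto simp: saturation_def)
    have "v \<otimes> y \<in> Q" using Q.I_l_closed y(1) v(1) D_carrier by blast
    then have "(v \<otimes> y) \<otimes> s \<in> sat R" using mult_m v(2) s by blast
    moreover have "(v \<otimes> y) \<otimes> s = v \<otimes> (y \<otimes> s)" using v(1) D_carrier Qc y s by (simp add: m_assoc)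
    ultimately show ?thesis using saturation_cancel[OF v(1), of "y \<otimes> s" R] Qc y s by simp
  qed
  have qc: "q \<in> carrier S" using Qc q .
  obtain k0 :: nat where k0: "\<And>k i b. \<lbrakk>k0 \<le> k; k \<le> i; b \<in> carrier S\<rbrakk> \<Longrightarrow>
    \<exists>u\<in>R - Q. \<exists>r\<in>R. \<exists>c\<in>carrier S. u \<otimes> (q [^] k \<otimes> b) = r \<oplus> q [^] i \<otimes> c"
    using FCP_power_multiples[OF FCP carrier_is_subring _ qc] R_carrier by blast
  \<comment> \<open>A positive exponent, so that \<open>y\<close> lies in \<open>Q\<close>.\<close>
  define y where "y = q [^] Suc k0"
  have yQ: "y \<in> Q" unfolding y_def using Q.I_l_closed[OF q nat_pow_closed[OF qc, of k0]] by simp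
  have yc: "y \<in> carrier S" using Qc yQ .
  obtain u r c where u: "u \<in> R - Q" "r \<in> R" "c \<in> carrier S" "u \<otimes> (q [^] Suc k0 \<otimes> \<one>) = r \<oplus> q [^] (Suc k0 + Suc k0) \<otimes> c"
    using k0[of "Suc k0" "Suc k0 + Suc k0" \<one>] by auto
  have uc: "u \<in> carrier S" and rc: "r \<in> carrier S" using u D_carrier R_carrier by auto
  have "q [^] (Suc k0 + Suc k0) = y \<otimes> y"
    unfolding y_def using nat_pow_mult[OF qc, of "Suc k0" "Suc k0"] by simp
  then have uy: "u \<otimes> y = r \<oplus> (y \<otimes> y) \<otimes> c"
    using u(4) yc unfolding y_def[symmetric] by simp
  have "r = (r \<oplus> (y \<otimes> y) \<otimes> c) \<ominus> (y \<otimes> y) \<otimes> c" using rc yc u(3) by algebra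
  then have r_eq: "r = u \<otimes> y \<ominus> (y \<otimes> y) \<otimes> c" unfolding uy .
  have "r \<in> Q" unfolding r_eq a_minus_def
    using Q.I_l_closed[OF yQ uc] Q.I_l_closed[OF yQ yc] Q.I_r_closed u(3) by auto
  define e where "e = y \<otimes> c"
  have ec: "e \<in> carrier S" using yc u e_def by simp
  have eQ: "e \<in> Q" unfolding e_def using Q.I_r_closed[OF yQ u(3)] .
  \<comment> \<open>One factor \<open>y\<^sup>2 c\<close> of \<open>e\<^sup>2 = (y\<^sup>2 c) c\<close> is replaced by \<open>u y - r\<close>.\<close>
  have "e \<otimes> e = ((r \<oplus> (y \<otimes> y) \<otimes> c) \<ominus> r) \<otimes> c"
    unfolding e_def using yc u(3) rc by algebra
  then have ee: "e \<otimes> e = u \<otimes> e \<ominus> r \<otimes> c"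
    unfolding uy[symmetric] e_def using yc u(3) rc uc by (simp add: m_assoc) algebra
  have rs: "r \<otimes> (\<ominus> c) \<in> sat R" "r \<otimes> (\<ominus> c \<otimes> e) \<in> sat R"
    using mult_m[OF u(2) \<open>r \<in> Q\<close>] u(3) ec by simp_all
  have e2: "e [^] (2::nat) \<ominus> u \<otimes> e = r \<otimes> (\<ominus> c)"
  proof -
    have "e [^] (2::nat) \<ominus> u \<otimes> e = e \<otimes> e \<ominus> u \<otimes> e" using ec by (simp add: numeral_2_eq_2)
    also have "\<dots> = r \<otimes> (\<ominus> c)" unfolding ee using ec uc rc u(3) by algebra
    finally show ?thesis .
  qed
  have e3: "e [^] (3::nat) \<ominus> u \<otimes> e [^] (2::nat) = r \<otimes> (\<ominus> c \<otimes> e)"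
  proof -
    have "e [^] (3::nat) \<ominus> u \<otimes> e [^] (2::nat) = e \<otimes> e \<otimes> e \<ominus> u \<otimes> (e \<otimes> e)"
      using ec by (simp add: numeral_2_eq_2 numeral_3_eq_3)
    also have "\<dots> = (e \<otimes> e \<ominus> u \<otimes> e) \<otimes> e" using ec uc by algebra
    also have "\<dots> = r \<otimes> (\<ominus> c \<otimes> e)" unfolding ee using ec uc rc u(3) by algebra
    finally show ?thesis .
  qed
  have "u \<in> sat R" using u(1) saturation_extensive[of R] R_carrier by blast
  then have eT: "e \<in> sat R"
    using t_closed_saturation[OF t] rs ec unfolding t_closed_ext_def e2[symmetric] e3[symmetric] by blast
  have T: "subring (sat R) S" using saturation_subring[OF subring] by blast
  have "u \<otimes> y = r \<oplus> e \<otimes> y" unfolding uy e_def using yc u(3) by (simp add: m_ac)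
  moreover have "r \<oplus> e \<otimes> y \<in> sat R"
    using subringE(7)[OF T] mult_q[OF eQ eT yc] u(2) saturation_extensive[of R] R_carrier by blast
  ultimately have yT: "y \<in> sat R" using saturation_cancel[OF u(1)] yc by simp
  have "q \<otimes> \<one> \<in> sat R"
  proof (rule t_closed_descent[OF t carrier_is_subring qc, of k0])
    show "q [^] Suc k0 \<otimes> b \<in> sat R" if "b \<in> carrier S" for b
      using mult_q[OF yQ yT that] unfolding y_def .
  qed simp
  then show ?thesis using qc by simp
qed

end

text \<open>
  An ideal maximal among those disjoint from a multiplicatively closed set is prime; the last property
  records its maximality.
\<close>
lemma (in cring) prime_maximal_avoiding_submonoid:
  assumes D: "submonoid D R" and z: "\<zero> \<notin> D"
  obtains Q where "primeideal Q R" "Q \<inter> D = {}"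
    "\<And>m. \<lbrakk>m \<in> carrier R; m \<notin> Q\<rbrakk> \<Longrightarrow> \<exists>j\<in>Q. \<exists>s\<in>carrier R. j \<oplus> s \<otimes> m \<in> D"
proof -
  let ?A = "{I. ideal I R \<and> I \<inter> D = {}}"
  have "\<exists>Q\<in>?A. \<forall>J\<in>?A. Q \<subseteq> J \<longrightarrow> J = Q"
  proof (rule subset_Zorn_nonempty)
    show "?A \<noteq> {}" using zeroideal z by auto
    fix C assume "C \<noteq> {}" and C: "subset.chain ?A C"
    then have "subset.chain {I. ideal I R} C" by (auto simp: subset_chain_def)
    then have "ideal (\<Union>C) R" using chain_Union_is_ideal[of C] \<open>C \<noteq> {}\<close> by simp
    moreover have "\<Union>C \<inter> D = {}" using C by (auto simp: subset_chain_def)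
    ultimately show "\<Union>C \<in> ?A" by blast
  qed
  then obtain Q where QA: "Q \<in> ?A" and Qm: "\<forall>J\<in>?A. Q \<subseteq> J \<longrightarrow> J = Q" by (rule bexE)
  have Qi: "ideal Q R" and QD: "Q \<inter> D = {}" using QA by simp_all
  have Qmax: "J = Q" if "ideal J R" "J \<inter> D = {}" "Q \<subseteq> J" for J
    using Qm that by simp
  interpret Q: ideal Q R by (rule Qi)
  have out: "\<exists>j\<in>Q. \<exists>s\<in>carrier R. j \<oplus> s \<otimes> m \<in> D" if m: "m \<in> carrier R" "m \<notin> Q" for m
  proof (rule ccontr)
    assume neg: "\<not> ?thesis"
    let ?J = "Q <+>\<^bsub>R\<^esub> PIdl m"
    have J: "x \<in> ?J \<longleftrightarrow> (\<exists>j\<in>Q. \<exists>s\<in>carrier R. x = j \<oplus> s \<otimes> m)" for x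
      by (auto simp: set_add_def' cgenideal_def)
    have "ideal ?J R" by (rule add_ideals[OF Qi cgenideal_ideal[OF m(1)]])
    moreover have "?J \<inter> D = {}" using neg J by auto
    moreover have "Q \<subseteq> ?J"
    proof
      fix x assume x: "x \<in> Q"
      have "x = x \<oplus> \<zero> \<otimes> m" using m(1) Q.Icarr[OF x] by simp
      then show "x \<in> ?J" using x J by blast
    qed
    ultimately have "?J = Q" by (rule Qmax)
    moreover have "m = \<zero> \<oplus> \<one> \<otimes> m" using m(1) by simp
    then have "m \<in> ?J" unfolding J using Q.zero_closed one_closed by blast
    ultimately show False using m(2) by blast
  qed
  have oneD: "\<one> \<in> D" using submonoid.one_closed[OF D] .
  have "primeideal Q R"
  proof (rule primeidealI[OF Qi is_cring])
    show "carrier R \<noteq> Q" using oneD QD by auto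
    fix a b assume ab: "a \<in> carrier R" "b \<in> carrier R" "a \<otimes> b \<in> Q"
    show "a \<in> Q \<or> b \<in> Q"
    proof (rule ccontr)
      assume "\<not> (a \<in> Q \<or> b \<in> Q)"
      then obtain j s j' s' where js: "j \<in> Q" "s \<in> carrier R" "j \<oplus> s \<otimes> a \<in> D"
          "j' \<in> Q" "s' \<in> carrier R" "j' \<oplus> s' \<otimes> b \<in> D"
        using out ab by meson
      have c: "j \<in> carrier R" "j' \<in> carrier R" using js Q.Icarr by auto
      have "(j \<oplus> s \<otimes> a) \<otimes> (j' \<oplus> s' \<otimes> b) = j \<otimes> (j' \<oplus> s' \<otimes> b) \<oplus> (s \<otimes> a) \<otimes> j' \<oplus> (s \<otimes> s') \<otimes> (a \<otimes> b)"
        using c js(2,5) ab(1,2) by algebra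
      moreover have "j \<otimes> (j' \<oplus> s' \<otimes> b) \<oplus> (s \<otimes> a) \<otimes> j' \<oplus> (s \<otimes> s') \<otimes> (a \<otimes> b) \<in> Q"
        using js ab c Q.I_l_closed Q.I_r_closed by simp
      moreover have "(j \<oplus> s \<otimes> a) \<otimes> (j' \<oplus> s' \<otimes> b) \<in> D"
        using submonoid.m_closed[OF D] js by blast
      ultimately show False using QD by auto
    qed
  qed
  then show ?thesis using QD out by (rule that)
qed

context ring_ext
begin

text \<open>
  Take a prime ideal \<open>Q\<close> of \<open>S\<close> maximal with respect to avoiding \<open>1 + a\<close>.  If some \<open>m \<in> a\<close> were outside \<open>Q\<close>,
  maximality would give \<open>w = j + s m\<close> in \<open>1 + a\<close> with \<open>j \<in> Q\<close>.  An integral equation of \<open>s\<close>, multiplied by a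
  power of \<open>m\<close>, becomes a monic equation for \<open>s m\<close> whose lower coefficients lie in \<open>a\<close>; since \<open>s m\<close> agrees
  with \<open>w\<close> modulo \<open>Q\<close>, it would force an element of \<open>1 + a\<close> into \<open>Q\<close>.
\<close>
lemma lying_over_ideal:
  assumes int: "integral_ext R S"
    and a: "ideal a (S\<lparr>carrier := R\<rparr>)" and one: "\<one> \<notin> a"
  obtains Q where "primeideal Q S" "a \<subseteq> Q"
proof -
  have aR: "a \<subseteq> R" using ideal.Icarr[OF a] by auto
  have ac: "x \<in> a \<Longrightarrow> x \<in> carrier S" for x using aR R_carrier by blast
  have a0: "\<zero> \<in> a"
    using additive_subgroup.zero_closed[OF ideal.axioms(1)[OF a]] by simp
  have aadd: "x \<oplus> y \<in> a" if "x \<in> a" "y \<in> a" for x y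
    using additive_subgroup.a_closed[OF ideal.axioms(1)[OF a], of x y] that by simp
  have amult: "r \<otimes> x \<in> a" if "x \<in> a" "r \<in> R" for x r
    using ideal.I_l_closed[OF a, of x r] that by simp
  define D where "D = (\<lambda>x. \<one> \<oplus> x) ` a"
  have Dadd: "d \<oplus> x \<in> D" if "d \<in> D" "x \<in> a" for d x
    using that ac aadd by (auto simp: D_def a_assoc)
  have DR: "d \<in> R" if "d \<in> D" for d using that aR R_add[OF R_one] by (auto simp: D_def)
  have one_D: "\<one> \<in> D" using imageI[OF a0, of "\<lambda>x. \<one> \<oplus> x"] by (simp add: D_def)
  have Dmult: "d \<otimes> d' \<in> D" if d: "d \<in> D" "d' \<in> D" for d d'
  proof -
    obtain x where x: "x \<in> a" "d' = \<one> \<oplus> x" using d by (auto simp: D_def)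
    have "d \<otimes> d' = d \<oplus> d \<otimes> x" using x ac DR[OF d(1)] R_carrier by (simp add: r_distr)
    then show ?thesis using Dadd amult d x DR by simp
  qed
  have "submonoid D S"
    using DR R_carrier one_D Dmult by (intro submonoid.intro) auto
  moreover have "\<zero> \<notin> D"
  proof
    assume "\<zero> \<in> D"
    then obtain x where x: "x \<in> a" "\<zero> = \<one> \<oplus> x" by (auto simp: D_def)
    then have "\<ominus> \<one> \<otimes> x = \<one>"
      using ac by (metis l_minus l_one minus_equality minus_minus one_closed a_comm)
    then show False using one amult[OF x(1) R_neg[OF R_one]] by simp
  qed
  ultimately obtain Q where Q: "primeideal Q S" "Q \<inter> D = {}"
    and Qout: "\<And>m. \<lbrakk>m \<in> carrier S; m \<notin> Q\<rbrakk> \<Longrightarrow> \<exists>j\<in>Q. \<exists>s\<in>carrier S. j \<oplus> s \<otimes> m \<in> D"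
    using prime_maximal_avoiding_submonoid by metis
  interpret Q: primeideal Q S by (rule Q(1))
  have "a \<subseteq> Q"
  proof (rule ccontr)
    assume "\<not> a \<subseteq> Q"
    then obtain m where m: "m \<in> a" "m \<notin> Q" by blast
    then obtain j s where js: "j \<in> Q" "s \<in> carrier S" "j \<oplus> s \<otimes> m \<in> D"
      using Qout ac by meson
    have mc: "m \<in> carrier S" and jc: "j \<in> carrier S" using ac m Q.Icarr js by auto
    define w where "w = j \<oplus> s \<otimes> m"
    have w: "w \<in> D" and wc: "w \<in> carrier S" using js mc jc by (auto simp: w_def)
    \<comment> \<open>Horner's scheme for the monic polynomial, scaled by \<open>m\<close> at each step: modulo \<open>Q\<close> the value remains
      in \<open>1 + a\<close>.\<close>
    have "\<exists>d\<in>D. \<exists>i\<in>Q. m [^] length p \<otimes> eval (\<one> # p) s = d \<oplus> i" if "set p \<subseteq> R" for p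
      using that
    proof (induction p rule: rev_induct)
      case Nil
      have "m [^] length [] \<otimes> eval [\<one>] s = \<one> \<oplus> \<zero>" using js by simp
      then show ?case using one_D Q.zero_closed by blast
    next
      case (snoc b p)
      then obtain d i where di: "d \<in> D" "i \<in> Q" "m [^] length p \<otimes> eval (\<one> # p) s = d \<oplus> i" by auto
      have b: "b \<in> R" "set (\<one> # p) \<subseteq> carrier S" using snoc.prems R_carrier by auto
      define E where "E = eval (\<one> # p) s"
      define M where "M = m [^] length p"
      have Ec: "E \<in> carrier S" unfolding E_def using eval_in_carrier[OF b(2) js(2)] .
      have Mc: "M \<in> carrier S" unfolding M_def using mc by simp
      have MR: "M \<in> R" unfolding M_def using m aR R_pow by blast
      have c: "d \<in> carrier S" "i \<in> carrier S" "b \<in> carrier S" using di b DR R_carrier Q.Icarr by auto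
      have "eval (\<one> # (p @ [b])) s = E \<otimes> s \<oplus> b"
        using eval_append_aux[OF b(2) c(3) js(2)] unfolding E_def by simp
      then have "m [^] length (p @ [b]) \<otimes> eval (\<one> # (p @ [b])) s = (M \<otimes> m) \<otimes> (E \<otimes> s \<oplus> b)"
        unfolding M_def by simp
      also have "\<dots> = (M \<otimes> E) \<otimes> ((j \<oplus> s \<otimes> m) \<ominus> j) \<oplus> (M \<otimes> b) \<otimes> m"
        using c Ec Mc mc js(2) jc by algebra
      also have "\<dots> = (d \<oplus> i) \<otimes> (w \<ominus> j) \<oplus> (M \<otimes> b) \<otimes> m"
        unfolding w_def using di(3) by (simp add: E_def M_def)
      also have "\<dots> = (d \<otimes> w \<oplus> (M \<otimes> b) \<otimes> m) \<oplus> (i \<otimes> (w \<ominus> j) \<oplus> d \<otimes> (\<ominus> j))"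
        using c Mc mc wc jc by algebra
      finally have eq: "m [^] length (p @ [b]) \<otimes> eval (\<one> # (p @ [b])) s
        = (d \<otimes> w \<oplus> (M \<otimes> b) \<otimes> m) \<oplus> (i \<otimes> (w \<ominus> j) \<oplus> d \<otimes> (\<ominus> j))" .
      have "d \<otimes> w \<oplus> (M \<otimes> b) \<otimes> m \<in> D"
        using Dadd[OF Dmult[OF di(1) w] amult[OF m(1) R_mult[OF MR b(1)]]] .
      moreover have "i \<otimes> (w \<ominus> j) \<oplus> d \<otimes> (\<ominus> j) \<in> Q"
        using Q.I_r_closed[OF di(2), of "w \<ominus> j"] Q.I_l_closed[of "\<ominus> j" d] js c wc jc by simp
      ultimately show ?case unfolding eq by blast
    qed
    moreover obtain p where "set p \<subseteq> R" "eval (\<one> # p) s = \<zero>"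
      using int js(2) unfolding integral_ext_def by blast
    ultimately obtain d i where di: "d \<in> D" "i \<in> Q" "m [^] length p \<otimes> \<zero> = d \<oplus> i" by metis
    then have "d \<oplus> i = \<zero>" using mc by simp
    then have "d = \<ominus> i" using di Q.Icarr DR R_carrier by (metis minus_equality)
    then show False using di Q(2) Q.a_inv_closed by auto
  qed
  with Q(1) show ?thesis by (rule that)
qed

text \<open>
  Modulo \<open>Q\<close>, strip from a monic equation of \<open>t\<close> its constant terms as long as they lie in \<open>Q\<close>, cancelling a factor
  \<open>t\<close> each time.  The leading coefficient \<open>1\<close> is not in \<open>Q\<close>, so some constant term \<open>r \<notin> Q\<close> is met; it is a
  multiple of \<open>t\<close> modulo \<open>Q\<close>.  This is what makes the residue field of \<open>S\<close> a ring of fractions over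
  \<open>R - Q\<close>.
\<close>
lemma multiple_in_base_modulo_prime:
  assumes int: "integral_ext R S" and Q: "primeideal Q S" and t: "t \<in> carrier S" "t \<notin> Q"
  shows "\<exists>s\<in>carrier S. \<exists>r\<in>R - Q. t \<otimes> s \<ominus> r \<in> Q"
proof -
  interpret Q: primeideal Q S by (rule Q)
  have "\<exists>s\<in>carrier S. \<exists>r\<in>R - Q. t \<otimes> s \<ominus> r \<in> Q"
    if "set p \<subseteq> R" "eval (\<one> # p) t \<in> Q" for p
    using that
  proof (induction p rule: rev_induct)
    case Nil
    then have "\<one> \<in> Q" using t by simp
    then show ?case using Q.one_imp_carrier Q.I_notcarr by blast
  next
    case (snoc b p)
    have b: "b \<in> R" "b \<in> carrier S" "set (\<one> # p) \<subseteq> carrier S" using snoc.prems R_carrier by auto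
    define E where "E = eval (\<one> # p) t"
    have Ec: "E \<in> carrier S" unfolding E_def using eval_in_carrier[OF b(3) t(1)] .
    have "eval (\<one> # (p @ [b])) t = E \<otimes> t \<oplus> b"
      using eval_append_aux[OF b(3) b(2) t(1)] unfolding E_def by simp
    then have EQ: "E \<otimes> t \<oplus> b \<in> Q" using snoc.prems by simp
    show ?case
    proof (cases "b \<in> Q")
      case True
      have "E \<otimes> t = (E \<otimes> t \<oplus> b) \<oplus> (\<ominus> b)" using Ec t b by algebra
      moreover have "(E \<otimes> t \<oplus> b) \<oplus> (\<ominus> b) \<in> Q" by (rule Q.a_closed[OF EQ Q.a_inv_closed[OF True]])
      ultimately have "E \<otimes> t \<in> Q" by metis
      then have "E \<in> Q" using Q.I_prime[OF Ec t(1)] t(2) by blast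
      then show ?thesis using snoc E_def by simp
    next
      case False
      have "t \<otimes> (\<ominus> E) \<ominus> b = \<ominus> (E \<otimes> t \<oplus> b)" using Ec t b by algebra
      moreover have "\<ominus> (E \<otimes> t \<oplus> b) \<in> Q" using EQ by (rule Q.a_inv_closed)
      ultimately show ?thesis using False b Ec by (metis DiffI a_inv_closed)
    qed
  qed
  moreover obtain p where "set p \<subseteq> R" "eval (\<one> # p) t = \<zero>"
    using int t(1) unfolding integral_ext_def by blast
  ultimately show ?thesis using Q.zero_closed by metis
qed

end

section \<open>Localization\<close>

locale cring_denominators = cring A for A (structure) +
  fixes M :: "'a set"
  assumes M_submonoid: "submonoid M A"
begin

lemma M_carrier: "s \<in> M \<Longrightarrow> s \<in> carrier A"
  using submonoid.subset[OF M_submonoid] by blast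

lemma M_one: "\<one> \<in> M" using submonoid.one_closed[OF M_submonoid] .

lemma M_mult: "\<lbrakk>s \<in> M; t \<in> M\<rbrakk> \<Longrightarrow> s \<otimes> t \<in> M" using submonoid.m_closed[OF M_submonoid] .

abbreviation frac :: "'a \<Rightarrow> 'a \<Rightarrow> ('a \<times> 'a) set" where "frac \<equiv> loc_frac A M"

abbreviation loc :: "('a \<times> 'a) set ring" where "loc \<equiv> localization A M"

lemma loc_rel_iff:
  "((a, s), (b, t)) \<in> loc_rel A M \<longleftrightarrow> a \<in> carrier A \<and> s \<in> M \<and> b \<in> carrier A \<and> t \<in> M \<and>
     (\<exists>u \<in> M. u \<otimes> (a \<otimes> t) = u \<otimes> (b \<otimes> s))"
  by (simp add: loc_rel_def)

lemma loc_rel_trans: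
  assumes "((a, s), (b, t)) \<in> loc_rel A M" "((b, t), (c, r)) \<in> loc_rel A M"
  shows "((a, s), (c, r)) \<in> loc_rel A M"
proof -
  obtain u v where u: "u \<in> M" "u \<otimes> (a \<otimes> t) = u \<otimes> (b \<otimes> s)" and v: "v \<in> M" "v \<otimes> (b \<otimes> r) = v \<otimes> (c \<otimes> t)"
    and mem: "a \<in> carrier A" "b \<in> carrier A" "c \<in> carrier A" "s \<in> M" "t \<in> M" "r \<in> M"
    using assms unfolding loc_rel_iff by blast
  have c: "s \<in> carrier A" "t \<in> carrier A" "r \<in> carrier A" "u \<in> carrier A" "v \<in> carrier A"
    using mem u v M_carrier by auto
  have "(u \<otimes> v \<otimes> t) \<otimes> (a \<otimes> r) = (v \<otimes> r) \<otimes> (u \<otimes> (a \<otimes> t))" using mem(1-3) c by algebra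
  also have "\<dots> = (u \<otimes> s) \<otimes> (v \<otimes> (b \<otimes> r))" unfolding u(2) using mem(1-3) c by algebra
  also have "\<dots> = (u \<otimes> v \<otimes> t) \<otimes> (c \<otimes> s)" unfolding v(2) using mem(1-3) c by algebra
  finally have "(u \<otimes> v \<otimes> t) \<otimes> (a \<otimes> r) = (u \<otimes> v \<otimes> t) \<otimes> (c \<otimes> s)" .
  then show ?thesis unfolding loc_rel_iff using mem M_mult u v by blast
qed

lemma equiv_loc_rel: "equiv (carrier A \<times> M) (loc_rel A M)"
proof (rule equivI)
  show "loc_rel A M \<subseteq> (carrier A \<times> M) \<times> (carrier A \<times> M)" by (auto simp: loc_rel_def)
  show "refl_on (carrier A \<times> M) (loc_rel A M)"
    using M_one by (auto simp: refl_on_def loc_rel_iff)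
  show "sym (loc_rel A M)"
    by (rule symI) (metis loc_rel_iff surj_pair)
  show "trans (loc_rel A M)"
    by (rule transI) (metis loc_rel_trans surj_pair)
qed

lemma frac_eq_iff:
  assumes "a \<in> carrier A" "s \<in> M" "b \<in> carrier A" "t \<in> M"
  shows "frac a s = frac b t \<longleftrightarrow> (\<exists>u\<in>M. u \<otimes> (a \<otimes> t) = u \<otimes> (b \<otimes> s))"
  unfolding loc_frac_def using eq_equiv_class_iff[OF equiv_loc_rel, of "(a, s)" "(b, t)"] assms
  by (simp add: loc_rel_iff)

lemma frac_eqI:
  assumes "a \<in> carrier A" "s \<in> M" "b \<in> carrier A" "t \<in> M" "a \<otimes> t = b \<otimes> s"
  shows "frac a s = frac b t"
  using assms M_one frac_eq_iff by metis

lemma mem_frac_iff: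
  assumes "a \<in> carrier A" "s \<in> M"
  shows "(b, t) \<in> frac a s \<longleftrightarrow> b \<in> carrier A \<and> t \<in> M \<and> frac b t = frac a s"
  using assms frac_eq_iff unfolding loc_frac_def Image_singleton_iff loc_rel_iff by metis

lemma frac_carrier: "\<lbrakk>a \<in> carrier A; s \<in> M\<rbrakk> \<Longrightarrow> frac a s \<in> carrier loc"
  by (auto simp: localization_def loc_frac_def intro: quotientI)

lemma localizationE:
  assumes "x \<in> carrier loc"
  obtains a s where "a \<in> carrier A" "s \<in> M" "x = frac a s"
  using assms by (auto simp: localization_def loc_frac_def elim!: quotientE)

text \<open>
  The operations of the localization and the induced maps are unions over all representatives; such a
  union is the common value once that value is independent of the representative.
\<close>
lemma UN_fracs:
  assumes "a \<in> carrier A" "s \<in> M"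
    and "\<And>b t. \<lbrakk>b \<in> carrier A; t \<in> M; frac b t = frac a s\<rbrakk> \<Longrightarrow> f b t = c"
  shows "(\<Union>(b, t) \<in> frac a s. f b t) = c"
proof -
  have "(a, s) \<in> frac a s" using assms mem_frac_iff by blast
  moreover have "(case p of (b, t) \<Rightarrow> f b t) = c" if "p \<in> frac a s" for p
    using that assms mem_frac_iff[OF assms(1,2)] by (cases p) blast
  ultimately show ?thesis by (simp add: SUP_eq_const[of "frac a s"] ) blast
qed

lemma frac_mult:
  assumes "a \<in> carrier A" "s \<in> M" "b \<in> carrier A" "t \<in> M"
  shows "frac a s \<otimes>\<^bsub>loc\<^esub> frac b t = frac (a \<otimes> b) (s \<otimes> t)"
proof -
  have "frac (a' \<otimes> b') (s' \<otimes> t') = frac (a \<otimes> b) (s \<otimes> t)"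
    if 1: "a' \<in> carrier A" "s' \<in> M" "frac a' s' = frac a s" "b' \<in> carrier A" "t' \<in> M" "frac b' t' = frac b t"
    for a' s' b' t'
  proof -
    obtain u v where u: "u \<in> M" "u \<otimes> (a' \<otimes> s) = u \<otimes> (a \<otimes> s')" and v: "v \<in> M" "v \<otimes> (b' \<otimes> t) = v \<otimes> (b \<otimes> t')"
      using 1 assms frac_eq_iff by metis
    have c: "u \<in> carrier A" "v \<in> carrier A" "s \<in> carrier A" "t \<in> carrier A" "s' \<in> carrier A" "t' \<in> carrier A"
      using u v 1 assms M_carrier by auto
    have "(u \<otimes> v) \<otimes> ((a' \<otimes> b') \<otimes> (s \<otimes> t)) = (u \<otimes> (a' \<otimes> s)) \<otimes> (v \<otimes> (b' \<otimes> t))"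
      using c 1(1,4) by algebra
    also have "\<dots> = (u \<otimes> v) \<otimes> ((a \<otimes> b) \<otimes> (s' \<otimes> t'))"
      unfolding u(2) v(2) using c assms(1,3) by algebra
    finally show ?thesis using frac_eq_iff 1 assms u(1) v(1) M_mult m_closed by metis
  qed
  then show ?thesis
    unfolding localization_def monoid.simps
    by (intro UN_fracs assms) auto
qed

lemma frac_add:
  assumes "a \<in> carrier A" "s \<in> M" "b \<in> carrier A" "t \<in> M"
  shows "frac a s \<oplus>\<^bsub>loc\<^esub> frac b t = frac (a \<otimes> t \<oplus> b \<otimes> s) (s \<otimes> t)"
proof -
  have "frac (a' \<otimes> t' \<oplus> b' \<otimes> s') (s' \<otimes> t') = frac (a \<otimes> t \<oplus> b \<otimes> s) (s \<otimes> t)"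
    if 1: "a' \<in> carrier A" "s' \<in> M" "frac a' s' = frac a s" "b' \<in> carrier A" "t' \<in> M" "frac b' t' = frac b t"
    for a' s' b' t'
  proof -
    obtain u v where u: "u \<in> M" "u \<otimes> (a' \<otimes> s) = u \<otimes> (a \<otimes> s')" and v: "v \<in> M" "v \<otimes> (b' \<otimes> t) = v \<otimes> (b \<otimes> t')"
      using 1 assms frac_eq_iff by metis
    have c: "u \<in> carrier A" "v \<in> carrier A" "s \<in> carrier A" "t \<in> carrier A" "s' \<in> carrier A" "t' \<in> carrier A"
      using u v 1 assms M_carrier by auto
    have "(u \<otimes> v) \<otimes> ((a' \<otimes> t' \<oplus> b' \<otimes> s') \<otimes> (s \<otimes> t))
        = (v \<otimes> t \<otimes> t') \<otimes> (u \<otimes> (a' \<otimes> s)) \<oplus> (u \<otimes> s \<otimes> s') \<otimes> (v \<otimes> (b' \<otimes> t))"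
      using c 1(1,4) by algebra
    also have "\<dots> = (u \<otimes> v) \<otimes> ((a \<otimes> t \<oplus> b \<otimes> s) \<otimes> (s' \<otimes> t'))"
      unfolding u(2) v(2) using c assms(1,3) by algebra
    finally have "(u \<otimes> v) \<otimes> ((a' \<otimes> t' \<oplus> b' \<otimes> s') \<otimes> (s \<otimes> t)) = (u \<otimes> v) \<otimes> ((a \<otimes> t \<oplus> b \<otimes> s) \<otimes> (s' \<otimes> t'))" .
    moreover have "a' \<otimes> t' \<oplus> b' \<otimes> s' \<in> carrier A" "a \<otimes> t \<oplus> b \<otimes> s \<in> carrier A"
      using 1(1,4) assms(1,3) c by simp_all
    ultimately show ?thesis using frac_eq_iff M_mult 1(2,5) assms(2,4) u(1) v(1) by metis
  qed
  then show ?thesis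
    unfolding localization_def ring_record_simps
    by (intro UN_fracs assms) auto
qed

lemma loc_one: "\<one>\<^bsub>loc\<^esub> = frac \<one> \<one>" and loc_zero: "\<zero>\<^bsub>loc\<^esub> = frac \<zero> \<one>"
  by (simp_all add: localization_def)

lemma cring_localization: "cring loc"
proof (rule cringI)
  show "abelian_group loc"
  proof (rule abelian_groupI)
    fix x y assume xy: "x \<in> carrier loc" "y \<in> carrier loc"
    obtain a s b t where r: "a \<in> carrier A" "s \<in> M" "x = frac a s" "b \<in> carrier A" "t \<in> M" "y = frac b t"
      using xy by (elim localizationE)
    note c = r(1,4) M_carrier[OF r(2)] M_carrier[OF r(5)]
    show "x \<oplus>\<^bsub>loc\<^esub> y \<in> carrier loc"
      unfolding r(3,6) frac_add[OF r(1,2,4,5)] using c M_mult[OF r(2,5)] by (intro frac_carrier) auto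
    have "a \<otimes> t \<oplus> b \<otimes> s = b \<otimes> s \<oplus> a \<otimes> t" "s \<otimes> t = t \<otimes> s" using c by algebra+
    then show "x \<oplus>\<^bsub>loc\<^esub> y = y \<oplus>\<^bsub>loc\<^esub> x"
      unfolding r(3,6) frac_add[OF r(1,2,4,5)] frac_add[OF r(4,5,1,2)] by simp
    fix z assume "z \<in> carrier loc"
    then obtain d q where z: "d \<in> carrier A" "q \<in> M" "z = frac d q" by (elim localizationE)
    have qc: "q \<in> carrier A" using M_carrier z by blast
    have c2: "a \<otimes> t \<oplus> b \<otimes> s \<in> carrier A" "b \<otimes> q \<oplus> d \<otimes> t \<in> carrier A" using c z(1) qc by auto
    have "(a \<otimes> t \<oplus> b \<otimes> s) \<otimes> q \<oplus> d \<otimes> (s \<otimes> t) = a \<otimes> (t \<otimes> q) \<oplus> (b \<otimes> q \<oplus> d \<otimes> t) \<otimes> s"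
       "(s \<otimes> t) \<otimes> q = s \<otimes> (t \<otimes> q)"
      using c z(1) qc by algebra+
    then show "x \<oplus>\<^bsub>loc\<^esub> y \<oplus>\<^bsub>loc\<^esub> z = x \<oplus>\<^bsub>loc\<^esub> (y \<oplus>\<^bsub>loc\<^esub> z)"
      unfolding r(3,6) z(3) frac_add[OF r(1,2,4,5)] frac_add[OF r(4,5) z(1,2)]
        frac_add[OF c2(1) M_mult[OF r(2,5)] z(1,2)] frac_add[OF r(1,2) c2(2) M_mult[OF r(5) z(2)]]
      by simp
  next
    show "\<zero>\<^bsub>loc\<^esub> \<in> carrier loc" unfolding loc_zero using M_one by (simp add: frac_carrier)
    fix x assume "x \<in> carrier loc"
    then obtain a s where r: "a \<in> carrier A" "s \<in> M" "x = frac a s" by (elim localizationE)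
    note sc = M_carrier[OF r(2)]
    show "\<zero>\<^bsub>loc\<^esub> \<oplus>\<^bsub>loc\<^esub> x = x"
      unfolding r(3) loc_zero frac_add[OF zero_closed M_one r(1,2)] using r(1) sc by simp
    have "frac (\<ominus> a) s \<oplus>\<^bsub>loc\<^esub> x = \<zero>\<^bsub>loc\<^esub>"
      unfolding r(3) loc_zero frac_add[OF a_inv_closed[OF r(1)] r(2,1,2)]
      by (rule frac_eqI) (use r sc M_one M_mult in \<open>simp_all add: l_minus l_neg\<close>)
    then show "\<exists>y\<in>carrier loc. y \<oplus>\<^bsub>loc\<^esub> x = \<zero>\<^bsub>loc\<^esub>"
      using frac_carrier r by blast
  qed
  show "comm_monoid loc"
  proof (rule comm_monoidI)
    show "\<one>\<^bsub>loc\<^esub> \<in> carrier loc" unfolding loc_one using M_one by (simp add: frac_carrier)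
    fix x y assume xy: "x \<in> carrier loc" "y \<in> carrier loc"
    obtain a s b t where r: "a \<in> carrier A" "s \<in> M" "x = frac a s" "b \<in> carrier A" "t \<in> M" "y = frac b t"
      using xy by (elim localizationE)
    note c = r(1,4) M_carrier[OF r(2)] M_carrier[OF r(5)]
    show "x \<otimes>\<^bsub>loc\<^esub> y \<in> carrier loc"
      unfolding r(3,6) frac_mult[OF r(1,2,4,5)] using c M_mult[OF r(2,5)] by (intro frac_carrier) auto
    show "x \<otimes>\<^bsub>loc\<^esub> y = y \<otimes>\<^bsub>loc\<^esub> x"
      unfolding r(3,6) frac_mult[OF r(1,2,4,5)] frac_mult[OF r(4,5,1,2)] using c by (simp add: m_comm)
    show "\<one>\<^bsub>loc\<^esub> \<otimes>\<^bsub>loc\<^esub> x = x"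
      unfolding r(3) loc_one frac_mult[OF one_closed M_one r(1,2)] using c by simp
    fix z assume "z \<in> carrier loc"
    then obtain d q where z: "d \<in> carrier A" "q \<in> M" "z = frac d q" by (elim localizationE)
    have qc: "q \<in> carrier A" using M_carrier z by blast
    show "x \<otimes>\<^bsub>loc\<^esub> y \<otimes>\<^bsub>loc\<^esub> z = x \<otimes>\<^bsub>loc\<^esub> (y \<otimes>\<^bsub>loc\<^esub> z)"
      unfolding r(3,6) z(3) frac_mult[OF r(1,2,4,5)] frac_mult[OF r(4,5) z(1,2)]
        frac_mult[OF m_closed[OF c(1,2)] M_mult[OF r(2,5)] z(1,2)]
        frac_mult[OF r(1,2) m_closed[OF c(2) z(1)] M_mult[OF r(5) z(2)]]
      using c z(1) qc by (simp add: m_assoc)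
  qed
  fix x y z assume xyz: "x \<in> carrier loc" "y \<in> carrier loc" "z \<in> carrier loc"
  obtain a s b t where r: "a \<in> carrier A" "s \<in> M" "x = frac a s" "b \<in> carrier A" "t \<in> M" "y = frac b t"
    using xyz(1,2) by (elim localizationE)
  note c = r(1,4) M_carrier[OF r(2)] M_carrier[OF r(5)]
  obtain d q where z: "d \<in> carrier A" "q \<in> M" "z = frac d q" using xyz(3) by (elim localizationE)
  have qc: "q \<in> carrier A" using M_carrier z by blast
  have c2: "a \<otimes> t \<oplus> b \<otimes> s \<in> carrier A" using c by auto
  have c3: "(a \<otimes> t \<oplus> b \<otimes> s) \<otimes> d \<in> carrier A"
    "a \<otimes> d \<otimes> (t \<otimes> q) \<oplus> b \<otimes> d \<otimes> (s \<otimes> q) \<in> carrier A" using c z(1) qc by auto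
  show "(x \<oplus>\<^bsub>loc\<^esub> y) \<otimes>\<^bsub>loc\<^esub> z = x \<otimes>\<^bsub>loc\<^esub> z \<oplus>\<^bsub>loc\<^esub> y \<otimes>\<^bsub>loc\<^esub> z"
    unfolding r(3,6) z(3) frac_add[OF r(1,2,4,5)] frac_mult[OF c2 M_mult[OF r(2,5)] z(1,2)]
      frac_mult[OF r(1,2) z(1,2)] frac_mult[OF r(4,5) z(1,2)]
      frac_add[OF m_closed[OF c(1) z(1)] M_mult[OF r(2) z(2)] m_closed[OF c(2) z(1)] M_mult[OF r(5) z(2)]]
  proof (rule frac_eqI[OF c3(1) _ c3(2)])
    show "(a \<otimes> t \<oplus> b \<otimes> s) \<otimes> d \<otimes> (s \<otimes> q \<otimes> (t \<otimes> q)) =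
      (a \<otimes> d \<otimes> (t \<otimes> q) \<oplus> b \<otimes> d \<otimes> (s \<otimes> q)) \<otimes> (s \<otimes> t \<otimes> q)"
      using c z(1) qc by algebra
  qed (use r z M_mult in auto)
qed

lemma frac_ring_hom: "(\<lambda>a. frac a \<one>) \<in> ring_hom A loc"
proof (rule ring_hom_memI)
  fix a b assume ab: "a \<in> carrier A" "b \<in> carrier A"
  show "frac a \<one> \<in> carrier loc" using ab M_one by (simp add: frac_carrier)
  show "frac (a \<otimes> b) \<one> = frac a \<one> \<otimes>\<^bsub>loc\<^esub> frac b \<one>"
    unfolding frac_mult[OF ab(1) M_one ab(2) M_one] by simp
  show "frac (a \<oplus> b) \<one> = frac a \<one> \<oplus>\<^bsub>loc\<^esub> frac b \<one>"
    unfolding frac_add[OF ab(1) M_one ab(2) M_one] using ab by simp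
qed (simp add: loc_one)

lemma frac_neg:
  assumes "a \<in> carrier A" "s \<in> M"
  shows "\<ominus>\<^bsub>loc\<^esub> frac a s = frac (\<ominus> a) s"
proof -
  interpret L: cring loc by (rule cring_localization)
  have "frac (\<ominus> a) s \<oplus>\<^bsub>loc\<^esub> frac a s = \<zero>\<^bsub>loc\<^esub>"
    unfolding loc_zero frac_add[OF a_inv_closed[OF assms(1)] assms(2,1,2)]
    by (rule frac_eqI) (use assms M_carrier M_one M_mult in \<open>simp_all add: l_minus l_neg\<close>)
  then show ?thesis
    using L.minus_equality frac_carrier assms by simp
qed

end

section \<open>Residue fields and the residual map\<close>

definition residue_frac :: "('a, 'b) ring_scheme \<Rightarrow> 'a set \<Rightarrow> 'a \<Rightarrow> 'a \<Rightarrow> ('a \<times> 'a) set set" where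
  "residue_frac A P a s = loc_ideal A P +>\<^bsub>loc_prime A P\<^esub> loc_frac A (carrier A - P) a s"

locale prime_localization = primeideal P A for P and A (structure)

sublocale prime_localization \<subseteq> cring_denominators A "carrier A - P"
  using complement_submonoid[OF carrier_is_subring]
  by (intro cring_denominators.intro is_cring cring_denominators_axioms.intro)

context prime_localization
begin

text \<open>
  The fractions with numerator in \<open>P\<close> form an ideal, and \<open>p / s\<close> is the multiple \<open>(1 / s) (p / 1)\<close> of a
  generator, so the ideal generated by \<open>P\<close> is this one.
\<close>
lemma loc_ideal_eq: "loc_ideal A P = {frac p s |p s. p \<in> P \<and> s \<in> carrier A - P}"
  and ideal_loc_ideal: "ideal (loc_ideal A P) loc"
proof -
  interpret L: cring loc by (rule cring_localization)
  let ?J = "{frac p s |p s. p \<in> P \<and> s \<in> carrier A - P}"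
  have gen: "(\<lambda>p. frac p \<one>) ` P \<subseteq> carrier loc" using frac_carrier M_one Icarr by auto
  have I: "loc_ideal A P = Idl\<^bsub>loc\<^esub> ((\<lambda>p. frac p \<one>) ` P)"
    by (simp add: loc_ideal_def loc_prime_def)
  show id: "ideal (loc_ideal A P) loc" unfolding I by (rule L.genideal_ideal[OF gen])
  have J: "ideal ?J loc"
  proof (rule idealI[OF L.ring_axioms])
    show "subgroup ?J (add_monoid loc)"
    proof (rule L.add.subgroupI)
      show "?J \<subseteq> carrier loc" using frac_carrier Icarr by auto
      show "?J \<noteq> {}" using M_one additive_subgroup.zero_closed[OF additive_subgroup_axioms] by blast
      show "\<ominus>\<^bsub>loc\<^esub> x \<in> ?J" if x: "x \<in> ?J" for x
      proof -
        obtain p s where p: "x = frac p s" "p \<in> P" "s \<in> carrier A - P" using x by blast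
        then have "\<ominus>\<^bsub>loc\<^esub> x = frac (\<ominus> p) s" using frac_neg Icarr by simp
        then show ?thesis using a_inv_closed p by blast
      qed
      fix x y assume "x \<in> ?J" "y \<in> ?J"
      then obtain p s q t where p: "x = frac p s" "p \<in> P" "s \<in> carrier A - P"
        and q: "y = frac q t" "q \<in> P" "t \<in> carrier A - P" by blast
      have "x \<oplus>\<^bsub>loc\<^esub> y = frac (p \<otimes> t \<oplus> q \<otimes> s) (s \<otimes> t)"
        unfolding p q using frac_add Icarr p q by simp
      moreover have "p \<otimes> t \<oplus> q \<otimes> s \<in> P" using p q I_r_closed a_closed by simp
      ultimately show "x \<oplus>\<^bsub>loc\<^esub> y \<in> ?J" using M_mult p q by blast
    qed
    fix x y assume x: "x \<in> ?J" and y: "y \<in> carrier loc"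
    obtain p s where p: "x = frac p s" "p \<in> P" "s \<in> carrier A - P" using x by blast
    obtain a t where a: "a \<in> carrier A" "t \<in> carrier A - P" "y = frac a t"
      using y by (rule localizationE)
    have "y \<otimes>\<^bsub>loc\<^esub> x = frac (a \<otimes> p) (t \<otimes> s)"
      unfolding p a(3) using frac_mult Icarr p a by simp
    then show yx: "y \<otimes>\<^bsub>loc\<^esub> x \<in> ?J" using I_l_closed M_mult p a by blast
    have "x \<in> carrier loc" using p frac_carrier Icarr by simp
    then show "x \<otimes>\<^bsub>loc\<^esub> y \<in> ?J" using yx y L.m_comm by simp
  qed
  show "loc_ideal A P = ?J"
  proof
    have "(\<lambda>p. frac p \<one>) ` P \<subseteq> ?J" using M_one by blast
    then show "loc_ideal A P \<subseteq> ?J" unfolding I by (rule L.genideal_minimal[OF J])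
    show "?J \<subseteq> loc_ideal A P"
    proof
      fix x assume "x \<in> ?J"
      then obtain p s where p: "x = frac p s" "p \<in> P" "s \<in> carrier A - P" by blast
      have "x = frac \<one> s \<otimes>\<^bsub>loc\<^esub> frac p \<one>"
        unfolding p(1) using frac_mult[OF one_closed p(3) Icarr[OF p(2)] M_one] Icarr[OF p(2)] p(3) by simp
      moreover have "frac p \<one> \<in> loc_ideal A P" unfolding I using L.genideal_self[OF gen] p(2) by blast
      ultimately show "x \<in> loc_ideal A P"
        using ideal.I_l_closed[OF id] frac_carrier[OF one_closed p(3)] by simp
    qed
  qed
qed

lemma frac_in_loc_ideal_iff:
  assumes a: "a \<in> carrier A" "s \<in> carrier A - P"
  shows "frac a s \<in> loc_ideal A P \<longleftrightarrow> a \<in> P"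
proof
  assume "frac a s \<in> loc_ideal A P"
  then obtain p t where p: "frac a s = frac p t" "p \<in> P" "t \<in> carrier A - P"
    unfolding loc_ideal_eq by blast
  then obtain u where u: "u \<in> carrier A - P" "u \<otimes> (a \<otimes> t) = u \<otimes> (p \<otimes> s)"
    using frac_eq_iff[OF a Icarr[OF p(2)] p(3)] by blast
  have "u \<otimes> (p \<otimes> s) \<in> P" using p u a I_r_closed I_l_closed by simp
  then have "u \<otimes> (a \<otimes> t) \<in> P" using u(2) by simp
  then have "a \<otimes> t \<in> P" using I_prime[of u "a \<otimes> t"] u(1) a p(3) by blast
  then show "a \<in> P" using I_prime a p(3) by blast
qed (use a loc_ideal_eq in blast)

lemma residue_frac_eq: "residue_frac A P a s = loc_ideal A P +>\<^bsub>loc\<^esub> frac a s"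
  by (simp add: residue_frac_def loc_prime_def)

lemma residue_field_eq: "residue_field A P = loc Quot loc_ideal A P"
  by (simp add: residue_field_def loc_prime_def)

lemma cring_residue_field: "cring (residue_field A P)"
  unfolding residue_field_eq by (rule ideal.quotient_is_cring[OF ideal_loc_ideal cring_localization])

lemma residue_frac_closed:
  assumes "a \<in> carrier A" "s \<in> carrier A - P"
  shows "residue_frac A P a s \<in> carrier (residue_field A P)"
  unfolding residue_field_eq residue_frac_eq
  using ring_hom_closed[OF ideal.rcos_ring_hom[OF ideal_loc_ideal]] frac_carrier assms by blast

lemma residue_fieldE:
  assumes "x \<in> carrier (residue_field A P)"
  obtains a s where "a \<in> carrier A" "s \<in> carrier A - P" "x = residue_frac A P a s"
proof -
  obtain y where "y \<in> carrier loc" "x = loc_ideal A P +>\<^bsub>loc\<^esub> y"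
    using assms unfolding residue_field_eq FactRing_def A_RCOSETS_def' by auto
  then show ?thesis using that unfolding residue_frac_eq by (metis localizationE)
qed

lemma residue_ring_hom: "(\<lambda>a. residue_frac A P a \<one>) \<in> ring_hom A (residue_field A P)"
  using ring_hom_trans[OF frac_ring_hom ideal.rcos_ring_hom[OF ideal_loc_ideal]]
  unfolding residue_field_eq residue_frac_eq comp_def .

lemma residue_frac_cancel:
  assumes a: "a \<in> carrier A" and s: "s \<in> carrier A - P"
  shows "residue_frac A P a s \<otimes>\<^bsub>residue_field A P\<^esub> residue_frac A P s \<one> = residue_frac A P a \<one>"
proof -
  have sc: "s \<in> carrier A" using s by simp
  have "frac a s \<otimes>\<^bsub>loc\<^esub> frac s \<one> = frac a \<one>"
    unfolding frac_mult[OF a s sc M_one] using a s sc M_one by (intro frac_eqI) simp_all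
  then show ?thesis
    using ring_hom_mult[OF ideal.rcos_ring_hom[OF ideal_loc_ideal] frac_carrier[OF a s] frac_carrier[OF sc M_one]]
    unfolding residue_field_eq residue_frac_eq by simp
qed

lemma residue_frac_Units:
  assumes s: "s \<in> carrier A - P"
  shows "residue_frac A P s \<one> \<in> Units (residue_field A P)"
proof -
  interpret F: cring "residue_field A P" by (rule cring_residue_field)
  have "residue_frac A P \<one> s \<otimes>\<^bsub>residue_field A P\<^esub> residue_frac A P s \<one> = \<one>\<^bsub>residue_field A P\<^esub>"
    using residue_frac_cancel[OF one_closed s] ring_hom_one[OF residue_ring_hom] by simp
  moreover have c: "residue_frac A P \<one> s \<in> carrier (residue_field A P)"
    "residue_frac A P s \<one> \<in> carrier (residue_field A P)"
    using residue_frac_closed[OF one_closed s] residue_frac_closed[OF _ M_one] s by auto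
  ultimately show ?thesis
    unfolding Units_def using F.m_comm[OF c] by auto
qed

lemma residue_frac_zero_iff:
  assumes a: "a \<in> carrier A"
  shows "residue_frac A P a \<one> = \<zero>\<^bsub>residue_field A P\<^esub> \<longleftrightarrow> a \<in> P"
proof -
  interpret L: cring loc by (rule cring_localization)
  interpret J: ideal "loc_ideal A P" loc by (rule ideal_loc_ideal)
  have fc: "frac a \<one> \<in> carrier loc" using frac_carrier a M_one by simp
  have "residue_frac A P a \<one> = \<zero>\<^bsub>residue_field A P\<^esub> \<longleftrightarrow> loc_ideal A P +>\<^bsub>loc\<^esub> frac a \<one> = loc_ideal A P +>\<^bsub>loc\<^esub> \<zero>\<^bsub>loc\<^esub>"
    unfolding residue_field_eq residue_frac_eq FactRing_def using J.a_subset by simp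
  also have "\<dots> \<longleftrightarrow> frac a \<one> \<in> loc_ideal A P"
    using L.quotient_eq_iff_same_a_r_cos[OF ideal_loc_ideal fc L.zero_closed] fc by (simp add: a_minus_def)
  finally show ?thesis using frac_in_loc_ideal_iff[OF a M_one] by simp
qed

end

context ring_ext
begin

lemma cring_base: "cring (S\<lparr>carrier := R\<rparr>)"
  using subcring_iff[of R] subcringI'[OF subring] subringE(1)[OF subring] by simp

lemma base_a_inv: "r \<in> R \<Longrightarrow> \<ominus>\<^bsub>S\<lparr>carrier := R\<rparr>\<^esub> r = \<ominus> r"
proof -
  assume r: "r \<in> R"
  interpret B: cring "S\<lparr>carrier := R\<rparr>" by (rule cring_base)
  show ?thesis using B.minus_equality[of "\<ominus> r" r] r R_neg R_carrier by (simp add: l_neg)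
qed

lemma contraction_prime:
  assumes Q: "primeideal Q S"
  shows "primeideal (Q \<inter> R) (S\<lparr>carrier := R\<rparr>)"
proof -
  interpret Q: primeideal Q S by (rule Q)
  interpret B: cring "S\<lparr>carrier := R\<rparr>" by (rule cring_base)
  show ?thesis
  proof (rule primeidealI[OF idealI[OF B.ring_axioms] cring_base])
    show "subgroup (Q \<inter> R) (add_monoid (S\<lparr>carrier := R\<rparr>))"
    proof (rule B.add.subgroupI)
      show "\<ominus>\<^bsub>S\<lparr>carrier := R\<rparr>\<^esub> x \<in> Q \<inter> R" if "x \<in> Q \<inter> R" for x
        using that base_a_inv R_neg by simp
      show "Q \<inter> R \<noteq> {}"
        using R_zero additive_subgroup.zero_closed[OF Q.additive_subgroup_axioms] by blast
    qed (use R_add in auto)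
    show "x \<otimes>\<^bsub>S\<lparr>carrier := R\<rparr>\<^esub> a \<in> Q \<inter> R" "a \<otimes>\<^bsub>S\<lparr>carrier := R\<rparr>\<^esub> x \<in> Q \<inter> R"
      if "a \<in> Q \<inter> R" "x \<in> carrier (S\<lparr>carrier := R\<rparr>)" for a x
      using that Q.I_l_closed Q.I_r_closed R_mult R_carrier by simp_all
    show "carrier (S\<lparr>carrier := R\<rparr>) \<noteq> Q \<inter> R"
      using R_one Q.one_imp_carrier Q.I_notcarr by auto
    show "a \<in> Q \<inter> R \<or> b \<in> Q \<inter> R"
      if "a \<in> carrier (S\<lparr>carrier := R\<rparr>)" "b \<in> carrier (S\<lparr>carrier := R\<rparr>)"
        "a \<otimes>\<^bsub>S\<lparr>carrier := R\<rparr>\<^esub> b \<in> Q \<inter> R" for a b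
      using that Q.I_prime[of a b] R_carrier by auto
  qed
qed

text \<open>
  A representative of the class of \<open>r / u\<close> has the form \<open>p / s + r / u\<close> with \<open>p \<in> Q \<inter> R\<close>.  Its image in the
  localization of \<open>S\<close> is given by the same formula, where \<open>p / s\<close> again lies in the maximal ideal.  So
  every member of the union defining the residual map is the same coset.
\<close>
lemma residual_map_residue_frac:
  assumes Q: "primeideal Q S" and r: "r \<in> R" and u: "u \<in> R - Q"
  shows "residual_map S Q (residue_frac (S\<lparr>carrier := R\<rparr>) (Q \<inter> R) r u) = residue_frac S Q r u"
proof -
  let ?B = "S\<lparr>carrier := R\<rparr>" and ?P = "Q \<inter> R"
  interpret Q: prime_localization Q S using Q by (simp add: prime_localization_def)
  interpret P: prime_localization ?P ?B using contraction_prime[OF Q] by (simp add: prime_localization_def)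
  interpret L: cring Q.loc by (rule Q.cring_localization)
  have MR: "carrier ?B - ?P = R - Q" by auto
  have RQ: "s \<in> carrier S - Q" if "s \<in> R - Q" for s using that R_carrier by blast
  have map: "loc_map S Q (P.frac a s) = Q.frac a s" if as: "a \<in> R" "s \<in> R - Q" for a s
    unfolding loc_map_def
  proof (rule P.UN_fracs)
    fix b t assume b: "b \<in> carrier ?B" "t \<in> carrier ?B - ?P" "P.frac b t = P.frac a s"
    then obtain v where v: "v \<in> R - Q" "v \<otimes> (b \<otimes> s) = v \<otimes> (a \<otimes> t)"
      using P.frac_eq_iff[of b t a s] as b(1) b(2)[unfolded MR] b(3)[unfolded MR] unfolding MR by auto
    then show "Q.frac b t = Q.frac a s"
      using Q.frac_eq_iff[of b t a s] as b R_carrier by auto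
  qed (use as in auto)
  have "loc_ideal S Q +>\<^bsub>loc_prime S Q\<^esub> loc_map S Q x = residue_frac S Q r u"
    if x: "x \<in> residue_frac ?B ?P r u" for x
  proof -
    obtain j where j: "j \<in> loc_ideal ?B ?P" "x = j \<oplus>\<^bsub>P.loc\<^esub> P.frac r u"
      using x unfolding P.residue_frac_eq a_r_coset_def' by auto
    obtain p s where p': "j = P.frac p s" "p \<in> ?P" "s \<in> carrier ?B - ?P"
      using j(1)[unfolded P.loc_ideal_eq] by (elim CollectE exE conjE)
    then have p: "j = P.frac p s" "p \<in> Q" "p \<in> R" "s \<in> R - Q"
      unfolding MR by auto
    have D: "s \<otimes> u \<in> R - Q" using P.M_mult[of s u] p(4) u by auto
    have x_eq: "x = P.frac (p \<otimes> u \<oplus> r \<otimes> s) (s \<otimes> u)"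
      unfolding j(2) p(1) using P.frac_add[of p s r u] p u r by simp
    have "p \<otimes> u \<oplus> r \<otimes> s \<in> R" using p u r R_add R_mult by simp
    then have "loc_map S Q x = Q.frac (p \<otimes> u \<oplus> r \<otimes> s) (s \<otimes> u)"
      unfolding x_eq using map D by blast
    also have "\<dots> = Q.frac p s \<oplus>\<^bsub>Q.loc\<^esub> Q.frac r u"
      using Q.frac_add[of p s r u] p r u RQ R_carrier by simp
    finally have lm: "loc_map S Q x = Q.frac p s \<oplus>\<^bsub>Q.loc\<^esub> Q.frac r u" .
    have fc: "Q.frac p s \<in> carrier Q.loc" "Q.frac r u \<in> carrier Q.loc"
      using Q.frac_carrier p r u RQ R_carrier by auto
    have fp: "Q.frac p s \<in> loc_ideal S Q" using Q.frac_in_loc_ideal_iff[of p s] p RQ R_carrier by blast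
    have "(Q.frac p s \<oplus>\<^bsub>Q.loc\<^esub> Q.frac r u) \<ominus>\<^bsub>Q.loc\<^esub> Q.frac r u = Q.frac p s"
      using fc by (simp add: a_minus_def L.a_assoc L.r_neg)
    then have "loc_ideal S Q +>\<^bsub>Q.loc\<^esub> (Q.frac p s \<oplus>\<^bsub>Q.loc\<^esub> Q.frac r u) = loc_ideal S Q +>\<^bsub>Q.loc\<^esub> Q.frac r u"
      using L.quotient_eq_iff_same_a_r_cos[OF Q.ideal_loc_ideal L.add.m_closed[OF fc] fc(2)] fp by simp
    then show ?thesis unfolding lm Q.residue_frac_eq by (simp add: loc_prime_def)
  qed
  moreover have "P.frac r u \<in> residue_frac ?B ?P r u"
  proof -
    interpret LP: cring P.loc by (rule P.cring_localization)
    interpret J: ideal "loc_ideal ?B ?P" P.loc by (rule P.ideal_loc_ideal)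
    have "r \<in> carrier ?B" "u \<in> carrier ?B - ?P" using r u by auto
    then show ?thesis unfolding P.residue_frac_eq by (intro J.a_rcos_self P.frac_carrier)
  qed
  ultimately show ?thesis unfolding residual_map_def by blast
qed

lemma residual_map_image:
  assumes Q: "primeideal Q S"
  shows "residual_map S Q ` carrier (residue_field (S\<lparr>carrier := R\<rparr>) (Q \<inter> R))
    = {x \<in> carrier (residue_field S Q). \<exists>r\<in>R. \<exists>u\<in>R - Q.
         x \<otimes>\<^bsub>residue_field S Q\<^esub> residue_frac S Q u \<one> = residue_frac S Q r \<one>}"
    (is "?L = ?K")
proof -
  let ?B = "S\<lparr>carrier := R\<rparr>" and ?P = "Q \<inter> R"
  interpret Q: prime_localization Q S using Q by (simp add: prime_localization_def)
  interpret P: prime_localization ?P ?B using contraction_prime[OF Q] by (simp add: prime_localization_def)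
  interpret F: cring "residue_field S Q" by (rule Q.cring_residue_field)
  have RQ: "s \<in> carrier S - Q" if "s \<in> R - Q" for s using that R_carrier by blast
  show ?thesis
  proof
    show "?L \<subseteq> ?K"
    proof
      fix x assume "x \<in> ?L"
      then obtain y where y: "y \<in> carrier (residue_field ?B ?P)" "x = residual_map S Q y" by blast
      obtain r u where "r \<in> carrier ?B" "u \<in> carrier ?B - ?P" and yru: "y = residue_frac ?B ?P r u"
        using y(1) by (rule P.residue_fieldE)
      then have ru: "r \<in> R" "u \<in> R - Q" by auto
      have "x = residue_frac S Q r u"
        unfolding y(2) yru by (rule residual_map_residue_frac[OF Q ru])
      moreover note Q.residue_frac_closed[OF R_carrier[OF ru(1)] RQ[OF ru(2)]]
        Q.residue_frac_cancel[OF R_carrier[OF ru(1)] RQ[OF ru(2)]]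
      ultimately show "x \<in> ?K" using ru by simp (metis DiffI)
    qed
    show "?K \<subseteq> ?L"
    proof
      fix x assume "x \<in> ?K"
      then obtain r u where x: "x \<in> carrier (residue_field S Q)" and ru: "r \<in> R" "u \<in> R - Q"
        and eq: "x \<otimes>\<^bsub>residue_field S Q\<^esub> residue_frac S Q u \<one> = residue_frac S Q r \<one>" by blast
      have c: "residue_frac S Q r u \<in> carrier (residue_field S Q)"
        by (rule Q.residue_frac_closed[OF R_carrier[OF ru(1)] RQ[OF ru(2)]])
      have U: "residue_frac S Q u \<one> \<in> Units (residue_field S Q)"
        using Q.residue_frac_Units[OF RQ[OF ru(2)]] .
      have "residue_frac S Q r u \<otimes>\<^bsub>residue_field S Q\<^esub> residue_frac S Q u \<one> = residue_frac S Q r \<one>"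
        using Q.residue_frac_cancel[OF R_carrier[OF ru(1)] RQ[OF ru(2)]] .
      then have "x = residue_frac S Q r u"
        using eq F.Units_l_cancel[OF U x c] F.m_comm x c F.Units_closed[OF U] by metis
      then have "x = residual_map S Q (residue_frac ?B ?P r u)"
        using residual_map_residue_frac[OF Q ru] by simp
      moreover have "residue_frac ?B ?P r u \<in> carrier (residue_field ?B ?P)"
        using P.residue_frac_closed[of r u] ru by auto
      ultimately show "x \<in> ?L" by blast
    qed
  qed
qed

end

section \<open>Transfer of distributivity\<close>

text \<open>
  The properties of the residue field \<open>F\<close> that the transfer of distributivity rests on.  They abstract
  from its construction as a quotient of a localization.
\<close>
locale residue_extension = ring_ext S R for S (structure) and R +
  fixes Q :: "'a set" and F :: "('c, 'd) ring_scheme" and \<phi> :: "'a \<Rightarrow> 'c"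
  assumes prime: "primeideal Q S"
    and F_cring: "cring F"
    and hom: "\<phi> \<in> ring_hom S F"
    and kernel: "\<And>s. s \<in> carrier S \<Longrightarrow> \<phi> s = \<zero>\<^bsub>F\<^esub> \<longleftrightarrow> s \<in> Q"
    and units: "\<And>u. u \<in> R - Q \<Longrightarrow> \<phi> u \<in> Units F"
    and fractions: "\<And>x. x \<in> carrier F \<Longrightarrow> \<exists>s\<in>carrier S. \<exists>u\<in>R - Q. x \<otimes>\<^bsub>F\<^esub> \<phi> u = \<phi> s"
begin

sublocale ring_ext_denominators S R "R - Q"
  using primeideal.complement_submonoid[OF prime subring]
  by (intro ring_ext_denominators.intro ring_ext_axioms ring_ext_denominators_axioms.intro Diff_subset)

sublocale Q: primeideal Q S by (rule prime)

sublocale F: cring F by (rule F_cring)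

sublocale hom: ring_hom_cring S F \<phi>
  by (intro ring_hom_cring.intro is_cring F_cring ring_hom_cring_axioms.intro hom)

definition frac_image :: "'a set \<Rightarrow> 'c set" where
  "frac_image A = {x \<in> carrier F. \<exists>a\<in>A. \<exists>u\<in>R - Q. x \<otimes>\<^bsub>F\<^esub> \<phi> u = \<phi> a}"

definition preimage :: "'c set \<Rightarrow> 'a set" where
  "preimage Y = {s \<in> carrier S. \<phi> s \<in> Y}"

lemma frac_imageE:
  assumes "x \<in> frac_image A"
  obtains a u where "x \<in> carrier F" "a \<in> A" "u \<in> R - Q" "x \<otimes>\<^bsub>F\<^esub> \<phi> u = \<phi> a"
  using assms unfolding frac_image_def by blast

lemma frac_imageI:
  "\<lbrakk>x \<in> carrier F; a \<in> A; u \<in> R - Q; x \<otimes>\<^bsub>F\<^esub> \<phi> u = \<phi> a\<rbrakk> \<Longrightarrow> x \<in> frac_image A"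
  unfolding frac_image_def by blast

lemma frac_image_mono: "A \<subseteq> B \<Longrightarrow> frac_image A \<subseteq> frac_image B"
  unfolding frac_image_def by blast

lemma image_in_frac_image: "\<lbrakk>a \<in> A; a \<in> carrier S\<rbrakk> \<Longrightarrow> \<phi> a \<in> frac_image A"
  by (rule frac_imageI[of _ a _ \<one>]) (use D_one in simp_all)

lemma inv_in_frac_image_base:
  assumes "u \<in> R - Q" shows "inv\<^bsub>F\<^esub> (\<phi> u) \<in> frac_image R"
  by (rule frac_imageI[of _ \<one> _ u]) (use assms units R_one in simp_all)

lemma subring_frac_image:
  assumes A: "subring A S" and RA: "R \<subseteq> A"
  shows "subring (frac_image A) F"
proof (rule F.subringI)
  note AE = subringE(2,3,5,6,7)[OF A]
  have Ac: "x \<in> A \<Longrightarrow> x \<in> carrier S" for x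
    using subringE(1)[OF A] by blast
  show "frac_image A \<subseteq> carrier F" unfolding frac_image_def by blast
  show "\<one>\<^bsub>F\<^esub> \<in> frac_image A" using image_in_frac_image[OF AE(2)] by simp
  show "\<ominus>\<^bsub>F\<^esub> h \<in> frac_image A" if "h \<in> frac_image A" for h
    using that
  proof (rule frac_imageE)
    fix a u assume h: "h \<in> carrier F" "a \<in> A" "u \<in> R - Q" "h \<otimes>\<^bsub>F\<^esub> \<phi> u = \<phi> a"
    show ?thesis
      by (rule frac_imageI[of _ "\<ominus> a" _ u]) (use h AE Ac D_carrier in \<open>simp_all add: F.l_minus\<close>)
  qed
  fix x y assume "x \<in> frac_image A" "y \<in> frac_image A"
  then obtain a u b v where x: "x \<in> carrier F" "a \<in> A" "u \<in> R - Q" "x \<otimes>\<^bsub>F\<^esub> \<phi> u = \<phi> a"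
    and y: "y \<in> carrier F" "b \<in> A" "v \<in> R - Q" "y \<otimes>\<^bsub>F\<^esub> \<phi> v = \<phi> b"
    by (elim frac_imageE)
  have c: "a \<in> carrier S" "b \<in> carrier S" "u \<in> carrier S" "v \<in> carrier S"
    using Ac x y D_carrier by auto
  have pc: "\<phi> u \<in> carrier F" "\<phi> v \<in> carrier F" using c by auto
  have uvA: "u \<in> A" "v \<in> A" using x y RA by auto
  have "(x \<otimes>\<^bsub>F\<^esub> y) \<otimes>\<^bsub>F\<^esub> (\<phi> u \<otimes>\<^bsub>F\<^esub> \<phi> v) = (x \<otimes>\<^bsub>F\<^esub> \<phi> u) \<otimes>\<^bsub>F\<^esub> (y \<otimes>\<^bsub>F\<^esub> \<phi> v)"
    using x(1) y(1) pc by (simp add: F.m_ac)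
  then have "(x \<otimes>\<^bsub>F\<^esub> y) \<otimes>\<^bsub>F\<^esub> \<phi> (u \<otimes> v) = \<phi> (a \<otimes> b)" unfolding x(4) y(4) using c by simp
  then show "x \<otimes>\<^bsub>F\<^esub> y \<in> frac_image A"
    by (intro frac_imageI[of _ "a \<otimes> b" _ "u \<otimes> v"] AE D_mult F.m_closed x y)
  have "(x \<oplus>\<^bsub>F\<^esub> y) \<otimes>\<^bsub>F\<^esub> (\<phi> u \<otimes>\<^bsub>F\<^esub> \<phi> v) = (x \<otimes>\<^bsub>F\<^esub> \<phi> u) \<otimes>\<^bsub>F\<^esub> \<phi> v \<oplus>\<^bsub>F\<^esub> (y \<otimes>\<^bsub>F\<^esub> \<phi> v) \<otimes>\<^bsub>F\<^esub> \<phi> u"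
    using x(1) y(1) pc by (simp add: F.m_ac F.l_distr F.r_distr)
  then have "(x \<oplus>\<^bsub>F\<^esub> y) \<otimes>\<^bsub>F\<^esub> \<phi> (u \<otimes> v) = \<phi> (a \<otimes> v \<oplus> b \<otimes> u)" unfolding x(4) y(4) using c by simp
  then show "x \<oplus>\<^bsub>F\<^esub> y \<in> frac_image A"
    by (intro frac_imageI[of _ "a \<otimes> v \<oplus> b \<otimes> u" _ "u \<otimes> v"] AE D_mult F.a_closed x y uvA)
qed

lemma frac_image_intermediate:
  assumes "A \<in> intermediate_rings R S"
  shows "frac_image A \<in> intermediate_rings (frac_image R) F"
  using assms subring_frac_image frac_image_mono by (auto simp: intermediate_rings_def)

lemma preimage_intermediate:
  assumes Y: "Y \<in> intermediate_rings (frac_image R) F"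
  shows "preimage Y \<in> intermediate_rings R S" and "Q \<subseteq> preimage Y"
proof -
  have Ys: "subring Y F" and RY: "frac_image R \<subseteq> Y" using Y by (auto simp: intermediate_rings_def)
  note YE = subringE(2,3,5,6,7)[OF Ys]
  have "subring (preimage Y) S"
    by (rule subringI) (auto simp: preimage_def YE)
  moreover have "R \<subseteq> preimage Y"
  proof
    fix r assume r: "r \<in> R"
    then have "\<phi> r \<in> Y" using image_in_frac_image[OF r R_carrier[OF r]] RY by blast
    then show "r \<in> preimage Y" using R_carrier[OF r] by (simp add: preimage_def)
  qed
  ultimately show "preimage Y \<in> intermediate_rings R S" by (simp add: intermediate_rings_def)
  show "Q \<subseteq> preimage Y"
  proof
    fix q assume q: "q \<in> Q"
    then have "\<phi> q = \<zero>\<^bsub>F\<^esub>" using kernel[OF Q.Icarr[OF q]] by blast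
    then show "q \<in> preimage Y" using YE(1) Q.Icarr[OF q] by (simp add: preimage_def)
  qed
qed

lemma frac_image_preimage:
  assumes Y: "Y \<in> intermediate_rings (frac_image R) F"
  shows "frac_image (preimage Y) = Y"
proof -
  have Ys: "subring Y F" and RY: "frac_image R \<subseteq> Y" using Y by (auto simp: intermediate_rings_def)
  note YE = subringE(2,3,5,6,7)[OF Ys]
  show ?thesis
  proof
    show "frac_image (preimage Y) \<subseteq> Y"
    proof
      fix x assume "x \<in> frac_image (preimage Y)"
      then obtain a u where x: "x \<in> carrier F" "a \<in> preimage Y" "u \<in> R - Q" "x \<otimes>\<^bsub>F\<^esub> \<phi> u = \<phi> a"
        by (rule frac_imageE)
      have U: "\<phi> u \<in> Units F" using units x by blast
      have "x = (x \<otimes>\<^bsub>F\<^esub> \<phi> u) \<otimes>\<^bsub>F\<^esub> inv\<^bsub>F\<^esub> (\<phi> u)"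
        using x(1) U by (simp add: F.m_assoc F.Units_closed)
      moreover have "x \<otimes>\<^bsub>F\<^esub> \<phi> u \<in> Y" using x(2,4) by (simp add: preimage_def)
      ultimately show "x \<in> Y" using YE(4) inv_in_frac_image_base[OF x(3)] RY by (metis subsetD)
    qed
    show "Y \<subseteq> frac_image (preimage Y)"
    proof
      fix x assume x: "x \<in> Y"
      then have xc: "x \<in> carrier F" using subringE(1)[OF Ys] by blast
      obtain s u where s: "s \<in> carrier S" "u \<in> R - Q" "x \<otimes>\<^bsub>F\<^esub> \<phi> u = \<phi> s" using fractions[OF xc] by blast
      have "\<phi> u \<in> Y" using image_in_frac_image[of u R] s(2) D_carrier RY by blast
      then have "\<phi> s \<in> Y" using YE(4)[OF x] s(3) by metis
      then show "x \<in> frac_image (preimage Y)" using s xc frac_imageI by (simp add: preimage_def)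
    qed
  qed
qed

lemma compositum_intermediate:
  assumes "subring T S" "subring U S" "R \<subseteq> T"
  shows "compositum S T U \<in> intermediate_rings R S" "T \<subseteq> compositum S T U" "U \<subseteq> compositum S T U"
proof -
  have c: "T \<union> U \<subseteq> carrier S" using assms subringE(1) by blast
  show T: "T \<subseteq> compositum S T U" "U \<subseteq> compositum S T U"
    unfolding compositum_def using generate_ringE(2)[OF c refl] by simp_all
  show "compositum S T U \<in> intermediate_rings R S"
    using generate_ring_is_subring[OF c] subset_trans[OF assms(3) T(1)]
    by (simp add: intermediate_rings_def compositum_def)
qed

text \<open>
  The image of the compositum is a ring containing both images, which gives one inclusion.  For the other, the preimage
  of the compositum of the images is a ring containing \<open>T\<close> and \<open>U\<close>.
\<close>
lemma frac_image_compositum: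
  assumes T: "T \<in> intermediate_rings R S" and U: "U \<in> intermediate_rings R S"
  shows "frac_image (compositum S T U) = compositum F (frac_image T) (frac_image U)"
proof
  have sub: "subring T S" "subring U S" "R \<subseteq> T" using T U by (auto simp: intermediate_rings_def)
  have fsub: "subring (frac_image T) F" "subring (frac_image U) F" "frac_image R \<subseteq> frac_image T"
    using frac_image_intermediate[OF T] frac_image_intermediate[OF U] by (auto simp: intermediate_rings_def)
  note TU = compositum_intermediate[OF sub]
  have fc: "frac_image T \<union> frac_image U \<subseteq> carrier F" using fsub subringE(1) by blast
  have gen: "frac_image T \<union> frac_image U \<subseteq> compositum F (frac_image T) (frac_image U)"
    unfolding compositum_def by (rule F.generate_ringE(2)[OF fc refl])
  show "compositum F (frac_image T) (frac_image U) \<subseteq> frac_image (compositum S T U)"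
    unfolding compositum_def[of F]
  proof (rule F.generate_ring_min_subring1[OF fc])
    show "subring (frac_image (compositum S T U)) F"
      using frac_image_intermediate[OF TU(1)] by (simp add: intermediate_rings_def)
    show "frac_image T \<union> frac_image U \<subseteq> frac_image (compositum S T U)"
      using frac_image_mono TU by simp
  qed
  let ?Y = "compositum F (frac_image T) (frac_image U)"
  have Y: "?Y \<in> intermediate_rings (frac_image R) F"
    using F.generate_ring_is_subring[OF fc] gen fsub(3) by (auto simp: intermediate_rings_def compositum_def)
  have pre: "A \<subseteq> preimage ?Y" if "A \<subseteq> carrier S" "frac_image A \<subseteq> ?Y" for A
    using that image_in_frac_image[of _ A] by (auto simp: preimage_def)
  have "compositum S T U \<subseteq> preimage ?Y"
    unfolding compositum_def[of S]
  proof (rule generate_ring_min_subring1)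
    show c: "T \<union> U \<subseteq> carrier S" using sub subringE(1) by blast
    show "subring (preimage ?Y) S" using preimage_intermediate(1)[OF Y] by (simp add: intermediate_rings_def)
    show "T \<union> U \<subseteq> preimage ?Y" using pre[of T] pre[of U] c gen by simp
  qed
  then show "frac_image (compositum S T U) \<subseteq> ?Y"
    using frac_image_mono frac_image_preimage[OF Y] by blast
qed

text \<open>
  If \<open>\<phi> a / \<phi> u = \<phi> b / \<phi> v\<close> with \<open>a \<in> T\<close> and \<open>b \<in> U\<close>, then \<open>a v - b u\<close> lies in \<open>Q\<close>, so a suitable factor \<open>w\<close>
  brings it into \<open>U\<close>.  Then \<open>w v a\<close> is a common numerator in \<open>T \<inter> U\<close>.
\<close>
lemma frac_image_Int:
  assumes T: "T \<in> intermediate_rings R S" and U: "U \<in> intermediate_rings R S"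
    and QU: "Q \<subseteq> sat U"
  shows "frac_image (T \<inter> U) = frac_image T \<inter> frac_image U"
proof
  have sub: "subring T S" "subring U S" "R \<subseteq> T" "R \<subseteq> U" using T U by (auto simp: intermediate_rings_def)
  note TE = subringE(6)[OF sub(1)] and UE = subringE(6,7)[OF sub(2)]
  have Tc: "x \<in> T \<Longrightarrow> x \<in> carrier S" and Uc: "x \<in> U \<Longrightarrow> x \<in> carrier S" for x
    using subringE(1)[OF sub(1)] subringE(1)[OF sub(2)] by blast+
  show "frac_image (T \<inter> U) \<subseteq> frac_image T \<inter> frac_image U" using frac_image_mono by blast
  show "frac_image T \<inter> frac_image U \<subseteq> frac_image (T \<inter> U)"
  proof
    fix x assume "x \<in> frac_image T \<inter> frac_image U"
    then obtain a u b v where x: "x \<in> carrier F" "a \<in> T" "u \<in> R - Q" "x \<otimes>\<^bsub>F\<^esub> \<phi> u = \<phi> a"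
      and y: "b \<in> U" "v \<in> R - Q" "x \<otimes>\<^bsub>F\<^esub> \<phi> v = \<phi> b"
      by (elim IntE frac_imageE)
    have c: "a \<in> carrier S" "b \<in> carrier S" "u \<in> carrier S" "v \<in> carrier S"
      using Tc Uc x y D_carrier by auto
    have pc: "\<phi> u \<in> carrier F" "\<phi> v \<in> carrier F" using c by auto
    have "\<phi> (a \<otimes> v) = (x \<otimes>\<^bsub>F\<^esub> \<phi> u) \<otimes>\<^bsub>F\<^esub> \<phi> v" unfolding x(4) using c by simp
    also have "\<dots> = (x \<otimes>\<^bsub>F\<^esub> \<phi> v) \<otimes>\<^bsub>F\<^esub> \<phi> u" using x(1) pc by (simp add: F.m_ac)
    also have "\<dots> = \<phi> (b \<otimes> u)" unfolding y(3) using c by simp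
    finally have "\<phi> (a \<otimes> v \<ominus> b \<otimes> u) = \<zero>\<^bsub>F\<^esub>" using c by (simp add: a_minus_def F.r_neg)
    moreover have "a \<otimes> v \<ominus> b \<otimes> u \<in> carrier S" using c by simp
    ultimately have "a \<otimes> v \<ominus> b \<otimes> u \<in> Q" using kernel by blast
    then obtain w where w: "w \<in> R - Q" "w \<otimes> (a \<otimes> v \<ominus> b \<otimes> u) \<in> U" using QU by (auto simp: saturation_def)
    have wc: "w \<in> carrier S" using w D_carrier by blast
    have "w \<otimes> (a \<otimes> v \<ominus> b \<otimes> u) \<oplus> (w \<otimes> u) \<otimes> b \<in> U"
      using UE w y x sub(4) by (meson Diff_iff subsetD)
    moreover have "w \<otimes> (a \<otimes> v \<ominus> b \<otimes> u) \<oplus> (w \<otimes> u) \<otimes> b = (w \<otimes> v) \<otimes> a" using c wc by algebra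
    ultimately have waU: "(w \<otimes> v) \<otimes> a \<in> U" by simp
    have waT: "(w \<otimes> v) \<otimes> a \<in> T" using TE x y w sub(3) by (meson Diff_iff subsetD)
    have wvu: "(w \<otimes> v) \<otimes> u \<in> R - Q" by (intro D_mult w y x)
    have "x \<otimes>\<^bsub>F\<^esub> \<phi> ((w \<otimes> v) \<otimes> u) = \<phi> ((w \<otimes> v) \<otimes> a)"
    proof -
      have "x \<otimes>\<^bsub>F\<^esub> \<phi> ((w \<otimes> v) \<otimes> u) = \<phi> (w \<otimes> v) \<otimes>\<^bsub>F\<^esub> (x \<otimes>\<^bsub>F\<^esub> \<phi> u)"
        using x(1) c wc by (simp add: F.m_ac)
      then show ?thesis unfolding x(4) using c wc by simp
    qed
    then show "x \<in> frac_image (T \<inter> U)"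
      by (rule frac_imageI[OF x(1) IntI[OF waT waU] wvu])
  qed
qed

lemma Int_intermediate:
  assumes "T \<in> intermediate_rings R S" "U \<in> intermediate_rings R S"
  shows "T \<inter> U \<in> intermediate_rings R S"
  using assms subring_inter by (auto simp: intermediate_rings_def)

text \<open>
  The distributive law is pulled back to preimages; these contain \<open>Q\<close>, so \<open>frac_image_Int\<close> applies
  to them.
\<close>
theorem distributive_residue_extension:
  assumes dist: "distributive_ext R S"
  shows "distributive_ext (frac_image R) F"
  unfolding distributive_ext_def
proof (intro ballI)
  fix T U V assume TUV: "T \<in> intermediate_rings (frac_image R) F"
    "U \<in> intermediate_rings (frac_image R) F" "V \<in> intermediate_rings (frac_image R) F"
  note T = preimage_intermediate[OF TUV(1)] frac_image_preimage[OF TUV(1)]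
    and U = preimage_intermediate[OF TUV(2)] frac_image_preimage[OF TUV(2)]
    and V = preimage_intermediate[OF TUV(3)] frac_image_preimage[OF TUV(3)]
  have sub: "subring (preimage U) S" "subring (preimage V) S" "R \<subseteq> preimage U"
    using U V by (auto simp: intermediate_rings_def)
  note UV = compositum_intermediate[OF sub]
  have sat: "Q \<subseteq> sat A" if "A \<in> intermediate_rings R S" "Q \<subseteq> A" for A
    using that saturation_extensive[of A] subringE(1)[of A S] by (auto simp: intermediate_rings_def)
  have "T \<inter> compositum F U V = frac_image (preimage T) \<inter> frac_image (compositum S (preimage U) (preimage V))"
    unfolding frac_image_compositum[OF U(1) V(1)] T(3) U(3) V(3) ..
  also have "\<dots> = frac_image (preimage T \<inter> compositum S (preimage U) (preimage V))"
    using frac_image_Int[OF T(1) UV(1)] sat[OF UV(1)] U(2) UV(2) by blast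
  also have "\<dots> = frac_image (compositum S (preimage T \<inter> preimage U) (preimage T \<inter> preimage V))"
    using dist T(1) U(1) V(1) unfolding distributive_ext_def by simp
  also have "\<dots> = compositum F (frac_image (preimage T \<inter> preimage U)) (frac_image (preimage T \<inter> preimage V))"
    by (rule frac_image_compositum[OF Int_intermediate[OF T(1) U(1)] Int_intermediate[OF T(1) V(1)]])
  also have "\<dots> = compositum F (T \<inter> U) (T \<inter> V)"
    using frac_image_Int[OF T(1) U(1) sat[OF U(1,2)]] frac_image_Int[OF T(1) V(1) sat[OF V(1,2)]]
    unfolding T(3) U(3) V(3) by simp
  finally show "T \<inter> compositum F U V = compositum F (T \<inter> U) (T \<inter> V)" .
qed

text \<open>
  When \<open>Q\<close> is locally contained in \<open>R\<close>, it is locally contained in every intermediate ring.  Then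
  \<open>frac_image\<close> commutes with intersections, and membership of \<open>x\<close> in an intermediate ring can be tested,
  up to a factor in \<open>R - Q\<close>, in the residue field.
\<close>
theorem locally_distributive:
  assumes dist: "distributive_ext (frac_image R) F" and QR: "Q \<subseteq> sat R"
    and T: "T \<in> intermediate_rings R S" and U: "U \<in> intermediate_rings R S" and V: "V \<in> intermediate_rings R S"
    and x: "x \<in> T \<inter> compositum S U V"
  shows "\<exists>u\<in>R - Q. u \<otimes> x \<in> compositum S (T \<inter> U) (T \<inter> V)"
proof -
  let ?W = "compositum S (T \<inter> U) (T \<inter> V)"
  have sat: "Q \<subseteq> sat A" if "A \<in> intermediate_rings R S" for A
    using that QR saturation_mono[of R A] by (auto simp: intermediate_rings_def)
  have sub: "subring U S" "subring V S" "R \<subseteq> U" using U V by (auto simp: intermediate_rings_def)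
  note UV = compositum_intermediate[OF sub]
  note TU = Int_intermediate[OF T U] and TV = Int_intermediate[OF T V]
  have W: "subring ?W S" "R \<subseteq> ?W"
    using compositum_intermediate(1)[of "T \<inter> U" "T \<inter> V"] TU TV by (auto simp: intermediate_rings_def)
  have "frac_image T \<inter> frac_image (compositum S U V) = frac_image ?W"
    using dist frac_image_intermediate[OF T] frac_image_intermediate[OF U] frac_image_intermediate[OF V]
    unfolding distributive_ext_def frac_image_compositum[OF U V] frac_image_compositum[OF TU TV]
      frac_image_Int[OF T U sat[OF U]] frac_image_Int[OF T V sat[OF V]]
    by blast
  moreover have xc: "x \<in> carrier S" using x T subringE(1) by (auto simp: intermediate_rings_def)
  moreover have "\<phi> x \<in> frac_image T \<inter> frac_image (compositum S U V)"
    using x xc image_in_frac_image by blast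
  ultimately have "\<phi> x \<in> frac_image ?W" by simp
  then obtain w u where w: "w \<in> ?W" "u \<in> R - Q" "\<phi> x \<otimes>\<^bsub>F\<^esub> \<phi> u = \<phi> w" by (rule frac_imageE)
  have c: "w \<in> carrier S" "u \<in> carrier S" using w D_carrier subringE(1)[OF W(1)] by auto
  have "\<phi> (x \<otimes> u \<ominus> w) = \<zero>\<^bsub>F\<^esub>" using w(3) c xc by (simp add: a_minus_def F.r_neg)
  moreover have "x \<otimes> u \<ominus> w \<in> carrier S" using c xc by simp
  ultimately have "x \<otimes> u \<ominus> w \<in> Q" using kernel by blast
  then obtain v where v: "v \<in> R - Q" "v \<otimes> (x \<otimes> u \<ominus> w) \<in> R" using QR by (auto simp: saturation_def)
  have vc: "v \<in> carrier S" using v D_carrier by blast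
  have "v \<otimes> (x \<otimes> u \<ominus> w) \<oplus> v \<otimes> w \<in> ?W"
    using subringE(6,7)[OF W(1)] v w W(2) by (meson Diff_iff subsetD)
  moreover have "v \<otimes> (x \<otimes> u \<ominus> w) \<oplus> v \<otimes> w = (v \<otimes> u) \<otimes> x" using c vc xc by algebra
  ultimately show ?thesis using D_mult v w by metis
qed

end

context ring_ext
begin

lemma residue_extension_residue_field:
  assumes int: "integral_ext R S" and Q: "primeideal Q S"
  shows "residue_extension S R Q (residue_field S Q) (\<lambda>a. residue_frac S Q a \<one>)"
proof -
  interpret Q: prime_localization Q S using Q by (simp add: prime_localization_def)
  interpret F: cring "residue_field S Q" by (rule Q.cring_residue_field)
  let ?\<phi> = "\<lambda>a. residue_frac S Q a \<one>"
  interpret h: ring_hom_cring S "residue_field S Q" ?\<phi>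
    by (intro ring_hom_cring.intro is_cring Q.cring_residue_field ring_hom_cring_axioms.intro Q.residue_ring_hom)
  show ?thesis
  proof (intro residue_extension.intro ring_ext_axioms residue_extension_axioms.intro Q
      Q.cring_residue_field Q.residue_ring_hom)
    show "?\<phi> s = \<zero>\<^bsub>residue_field S Q\<^esub> \<longleftrightarrow> s \<in> Q" if "s \<in> carrier S" for s
      using Q.residue_frac_zero_iff[OF that] .
    show "?\<phi> u \<in> Units (residue_field S Q)" if "u \<in> R - Q" for u
      using that R_carrier by (intro Q.residue_frac_Units) blast
    fix x assume x: "x \<in> carrier (residue_field S Q)"
    obtain a t where a: "a \<in> carrier S" "t \<in> carrier S - Q" "x = residue_frac S Q a t"
      using x by (rule Q.residue_fieldE)
    obtain s r where s: "s \<in> carrier S" "r \<in> R - Q" "t \<otimes> s \<ominus> r \<in> Q"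
      using multiple_in_base_modulo_prime[OF int Q] a(2) by blast
    have c: "t \<in> carrier S" "r \<in> carrier S" using a s R_carrier by auto
    define q where "q = t \<otimes> s \<ominus> r"
    have q: "q \<in> carrier S" "q \<in> Q" using c s by (simp_all add: q_def)
    have "r = t \<otimes> s \<oplus> (\<ominus> q)" unfolding q_def using c s(1) by algebra
    then have "?\<phi> r = ?\<phi> (t \<otimes> s \<oplus> (\<ominus> q))" by (rule arg_cong)
    also have "\<dots> = ?\<phi> t \<otimes>\<^bsub>residue_field S Q\<^esub> ?\<phi> s \<oplus>\<^bsub>residue_field S Q\<^esub> (\<ominus>\<^bsub>residue_field S Q\<^esub> ?\<phi> q)"
      using c s(1) q(1) by simp
    also have "?\<phi> q = \<zero>\<^bsub>residue_field S Q\<^esub>" using Q.residue_frac_zero_iff[OF q(1)] q(2) by blast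
    finally have "?\<phi> r = ?\<phi> t \<otimes>\<^bsub>residue_field S Q\<^esub> ?\<phi> s" using c s(1) by simp
    then have "x \<otimes>\<^bsub>residue_field S Q\<^esub> ?\<phi> r = (x \<otimes>\<^bsub>residue_field S Q\<^esub> ?\<phi> t) \<otimes>\<^bsub>residue_field S Q\<^esub> ?\<phi> s"
      using x c s by (simp add: F.m_assoc)
    also have "\<dots> = ?\<phi> (a \<otimes> s)" unfolding a(3) Q.residue_frac_cancel[OF a(1,2)] using a s by simp
    finally show "\<exists>s\<in>carrier S. \<exists>u\<in>R - Q. x \<otimes>\<^bsub>residue_field S Q\<^esub> ?\<phi> u = ?\<phi> s"
      using a s by blast
  qed
qed

lemma distributive_residual_ext_iff:
  assumes int: "integral_ext R S" and Q: "primeideal Q S"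
  shows "distributive_residual_ext R S Q \<longleftrightarrow>
    distributive_ext
      (residue_extension.frac_image R Q (residue_field S Q) (\<lambda>a. residue_frac S Q a \<one>) R)
      (residue_field S Q)"
  unfolding distributive_residual_ext_def residual_map_image[OF Q]
    residue_extension.frac_image_def[OF residue_extension_residue_field[OF int Q]] ..

lemma compositum_least:
  assumes "subring T S" "subring U S" "subring W S" "T \<subseteq> W" "U \<subseteq> W"
  shows "compositum S T U \<subseteq> W"
  unfolding compositum_def
  by (rule generate_ring_min_subring1) (use assms(3-5) assms(1,2)[THEN subringE(1)] in blast)+

text \<open>
  The inclusion of \<open>T \<inter> U V\<close> in \<open>(T \<inter> U) (T \<inter> V)\<close> is checked locally: the ideal \<open>a\<close> of
  elements of \<open>R\<close> that carry \<open>x\<close> into the right-hand side contains an element outside each prime of \<open>S\<close>, so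
  it cannot lie in a prime of \<open>S\<close>.
\<close>
lemma distributive_if_residually_distributive:
  assumes int: "integral_ext R S" and t: "t_closed_ext R S" and FCP: "FCP_ext R S"
    and res: "\<And>Q. primeideal Q S \<Longrightarrow> distributive_residual_ext R S Q"
  shows "distributive_ext R S"
  unfolding distributive_ext_def
proof (intro ballI)
  fix T U V assume T: "T \<in> intermediate_rings R S" and U: "U \<in> intermediate_rings R S"
    and V: "V \<in> intermediate_rings R S"
  let ?W = "compositum S (T \<inter> U) (T \<inter> V)"
  have sub: "subring T S" "subring U S" "subring V S" "R \<subseteq> T" "R \<subseteq> U" "R \<subseteq> V"
    using T U V by (auto simp: intermediate_rings_def)
  have Tc: "T \<subseteq> carrier S" and Uc: "U \<union> V \<subseteq> carrier S" using sub subringE(1) by blast+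
  have UV: "subring (compositum S U V) S" "U \<union> V \<subseteq> compositum S U V"
    using generate_ringE(1,2)[OF Uc refl] by (auto simp: compositum_def)
  have Wc: "T \<inter> U \<union> T \<inter> V \<subseteq> carrier S" using Tc by blast
  have W: "subring ?W S" "R \<subseteq> ?W"
    using generate_ringE(1,2)[OF Wc refl] sub by (auto simp: compositum_def)
  note WE = subringE(2,3,5,6,7)[OF W(1)]
  show "T \<inter> compositum S U V = ?W"
  proof
    show "?W \<subseteq> T \<inter> compositum S U V"
      using UV sub by (intro compositum_least subring_inter) auto
    show "T \<inter> compositum S U V \<subseteq> ?W"
    proof (rule subsetI, rule ccontr)
      fix x assume x: "x \<in> T \<inter> compositum S U V" and xW: "x \<notin> ?W"
      have xc: "x \<in> carrier S" using x Tc by blast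
      define a where "a = {r \<in> R. r \<otimes> x \<in> ?W}"
      interpret B: cring "S\<lparr>carrier := R\<rparr>" by (rule cring_base)
      have "ideal a (S\<lparr>carrier := R\<rparr>)"
      proof (rule idealI[OF B.ring_axioms])
        show "subgroup a (add_monoid (S\<lparr>carrier := R\<rparr>))"
        proof (rule B.add.subgroupI)
          show "a \<subseteq> carrier (S\<lparr>carrier := R\<rparr>)" by (auto simp: a_def)
          show "a \<noteq> {}" using R_zero WE(1) xc by (auto simp: a_def)
          show "\<ominus>\<^bsub>S\<lparr>carrier := R\<rparr>\<^esub> r \<in> a" if "r \<in> a" for r
            using that base_a_inv R_neg WE(3) xc R_carrier by (simp add: a_def l_minus)
          show "r \<oplus>\<^bsub>S\<lparr>carrier := R\<rparr>\<^esub> r' \<in> a" if "r \<in> a" "r' \<in> a" for r r'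
            using that R_add WE(5) xc R_carrier by (simp add: a_def l_distr)
        qed
        have *: "r' \<otimes> r \<in> a" if "r \<in> a" "r' \<in> R" for r r'
          using that R_mult WE(4) W(2) xc R_carrier by (auto simp: a_def m_assoc)
        then show "r' \<otimes>\<^bsub>S\<lparr>carrier := R\<rparr>\<^esub> r \<in> a"
          if "r \<in> a" "r' \<in> carrier (S\<lparr>carrier := R\<rparr>)" for r r' using that by simp
        show "r \<otimes>\<^bsub>S\<lparr>carrier := R\<rparr>\<^esub> r' \<in> a"
          if "r \<in> a" "r' \<in> carrier (S\<lparr>carrier := R\<rparr>)" for r r'
          using *[of r r'] that m_comm[of r r'] R_carrier by (simp add: a_def)
      qed
      moreover have "\<one> \<notin> a" using xW xc by (simp add: a_def)
      ultimately obtain Q where Q: "primeideal Q S" and aQ: "a \<subseteq> Q"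
        using lying_over_ideal[OF int] by metis
      interpret residue_extension S R Q "residue_field S Q" "\<lambda>a. residue_frac S Q a \<one>"
        by (rule residue_extension_residue_field[OF int Q])
      have "distributive_ext (frac_image R) (residue_field S Q)"
        using res[OF Q] distributive_residual_ext_iff[OF int Q] by blast
      moreover have "Q \<subseteq> saturation S (R - Q) R"
        using prime_locally_in_base[OF int t FCP Q] by blast
      ultimately obtain u where "u \<in> R - Q" "u \<otimes> x \<in> ?W"
        using locally_distributive[OF _ _ T U V x] by blast
      then show False using aQ by (auto simp: a_def)
    qed
  qed
qed

end

theorem proposition4p5:
  fixes S :: "('a, 'b) ring_scheme" and R :: "'a set"
  assumes "cring S"
    and "subring R S"
    and "integral_ext R S"
    and "t_closed_ext R S"
    and "FCP_ext R S"
  shows "distributive_ext R S \<longleftrightarrow>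
    (\<forall>Q. primeideal Q S \<longrightarrow> distributive_residual_ext R S Q)"
proof -
  interpret ring_ext S R
    using assms(1,2) by (simp add: ring_ext_def ring_ext_axioms_def)
  show ?thesis
  proof (intro iffI allI impI)
    fix Q assume dist: "distributive_ext R S" and Q: "primeideal Q S"
    show "distributive_residual_ext R S Q"
      unfolding distributive_residual_ext_iff[OF assms(3) Q]
      by (rule residue_extension.distributive_residue_extension[OF residue_extension_residue_field[OF assms(3) Q] dist])
  next
    assume "\<forall>Q. primeideal Q S \<longrightarrow> distributive_residual_ext R S Q"
    then show "distributive_ext R S"
      by (intro distributive_if_residually_distributive[OF assms(3-5)]) blast
  qed
qed

end
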